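(* Let $d\geq 1$ and let $h>0$. Let $F:\mathbb{R}^{2d}\to\mathbb{R}$ be a smooth function, bounded as well as all its derivatives. Assume that $$F(x,\xi)=\Phi(|x|^2+|\xi|^2),\qquad (x,\xi)\in\mathbb{R}^{2d},$$ where $\Phi$ is a real-valued nondecreasing function defined on $[0,\infty)$. Then for all $f\in\mathcal{S}(\mathbb{R}^d)$, $$\langle \mathrm{Op}_h^{Weyl}(F)f,f\rangle\ \geq\ \left(\frac{1}{h}\int_0^{\infty}\Phi(t)e^{-t/h}\,dt\right)\|f\|_{L^2(\mathbb{R}^d)}^2 .$$
   Context: $\mathcal{S}(\mathbb{R}^d)$ is the Schwartz space of complex-valued functions, and $\langle f,g\rangle=\int_{\mathbb{R}^d} f\,\overline{g}$ is the $L^2(\mathbb{R}^d)$ inner product. For $f,g\in\mathcal{S}(\mathbb{R}^d)$ and $h>0$, the Wigner function is $$H_h(f,g,Z)=\int_{\mathbb{R}^d}e^{-\frac{i}{h}t\cdot\zeta}f\left(z+\tfrac t2\right)\overline{g\left(z-\tfrac t2\right)}\,dt,\qquad Z=(z,\zeta)\in\mathbb{R}^{2d}.$$ For $F$ smooth on $\mathbb{R}^{2d}$, bounded with all its derivatives, $\mathrm{Op}_h^{Weyl}(F)$ is the bounded operator on $L^2(\mathbb{R}^d)$ such that, for all $f,g\in\mathcal{S}(\mathbb{R}^d)$, $$\langle \mathrm{Op}_h^{Weyl}(F)f,g\rangle=(2\pi h)^{-d}\int_{\mathbb{R}^{2d}}F(Z)\,H_h(f,g,Z)\,dZ .$$ 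*)

theory Defs
  imports "HOL-Analysis.Analysis"
begin

text \<open>Iterated partial derivatives: the list contains the basis directions of
  differentiation, the head being the direction applied last.\<close>

fun partial_derivs :: "'a::euclidean_space list \<Rightarrow> ('a \<Rightarrow> 'b::real_normed_vector) \<Rightarrow> 'a \<Rightarrow> 'b" where
  "partial_derivs [] f = f"
| "partial_derivs (b # bs) f = (\<lambda>x. frechet_derivative (partial_derivs bs f) (at x) b)"

text \<open>Requiring every iterated partial derivative to be (Frechet) differentiable makes them all
  exist and be continuous, i.e. \<open>f\<close> is of class \<open>C\<^sup>\<infinity>\<close>.\<close>

definition smooth :: "('a::euclidean_space \<Rightarrow> 'b::real_normed_vector) \<Rightarrow> bool" where
  "smooth f \<longleftrightarrow> (\<forall>bs. set bs \<subseteq> Basis \<longrightarrow> (\<forall>x. partial_derivs bs f differentiable (at x)))"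

definition bounded_derivs :: "('a::euclidean_space \<Rightarrow> 'b::real_normed_vector) \<Rightarrow> bool" where
  "bounded_derivs f \<longleftrightarrow> (\<forall>bs. set bs \<subseteq> Basis \<longrightarrow> bounded (range (partial_derivs bs f)))"

definition schwartz :: "('a::euclidean_space \<Rightarrow> complex) set" where
  "schwartz = {f. smooth f \<and>
     (\<forall>k bs. set bs \<subseteq> Basis \<longrightarrow> bounded (range (\<lambda>x. norm x ^ k *\<^sub>R partial_derivs bs f x)))}"

text \<open>Elements of \<open>L\<^sup>2\<close> are represented by square-integrable Borel functions; they are to be
  identified when they agree almost everywhere.\<close>

definition L2_space :: "('a::euclidean_space \<Rightarrow> complex) set" where
  "L2_space = {f \<in> borel_measurable lborel. integrable lborel (\<lambda>x. (norm (f x))\<^sup>2)}"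

definition L2_inner :: "('a::euclidean_space \<Rightarrow> complex) \<Rightarrow> ('a \<Rightarrow> complex) \<Rightarrow> complex" where
  "L2_inner f g = (LINT x|lborel. f x * cnj (g x))"

definition L2_norm :: "('a::euclidean_space \<Rightarrow> complex) \<Rightarrow> real" where
  "L2_norm f = sqrt (LINT x|lborel. (norm (f x))\<^sup>2)"

text \<open>An operator acts on representatives. The first condition says that it descends to
  almost-everywhere classes, and linearity is understood in terms of these classes.\<close>

definition bounded_L2_operator ::
    "(('a::euclidean_space \<Rightarrow> complex) \<Rightarrow> ('a \<Rightarrow> complex)) \<Rightarrow> bool" where
  "bounded_L2_operator A \<longleftrightarrow>
     (\<forall>f\<in>L2_space. \<forall>g\<in>L2_space. (AE x in lborel. f x = g x) \<longrightarrow> (AE x in lborel. A f x = A g x)) \<and>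
     (\<forall>f\<in>L2_space. A f \<in> L2_space) \<and>
     (\<forall>f\<in>L2_space. \<forall>g\<in>L2_space. AE x in lborel. A (\<lambda>y. f y + g y) x = A f x + A g x) \<and>
     (\<forall>c. \<forall>f\<in>L2_space. AE x in lborel. A (\<lambda>y. c * f y) x = c * A f x) \<and>
     (\<exists>C. \<forall>f\<in>L2_space. L2_norm (A f) \<le> C * L2_norm f)"

definition wigner ::
    "real \<Rightarrow> ('a::euclidean_space \<Rightarrow> complex) \<Rightarrow> ('a \<Rightarrow> complex) \<Rightarrow> 'a \<times> 'a \<Rightarrow> complex" where
  "wigner h f g = (\<lambda>(z, \<zeta>). LINT t|lborel.
     exp (- (\<i> / complex_of_real h) * complex_of_real (t \<bullet> \<zeta>)) * f (z + t /\<^sub>R 2) * cnj (g (z - t /\<^sub>R 2)))"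

text \<open>\<open>A\<close> is the Weyl quantization of \<open>F\<close>. This determines \<open>A f\<close> up to almost-everywhere equality
  for each \<open>f\<close> in \<open>L\<^sup>2\<close>, since the Schwartz space is dense; for smooth \<open>F\<close> with bounded
  derivatives such an \<open>A\<close> exists by the Calderon-Vaillancourt theorem.\<close>

definition is_weyl_op ::
    "real \<Rightarrow> ('a::euclidean_space \<times> 'a \<Rightarrow> real) \<Rightarrow> (('a \<Rightarrow> complex) \<Rightarrow> ('a \<Rightarrow> complex)) \<Rightarrow> bool" where
  "is_weyl_op h F A \<longleftrightarrow> bounded_L2_operator A \<and>
     (\<forall>f\<in>schwartz. \<forall>g\<in>schwartz.
        L2_inner (A f) g =
          (LINT Z|lborel. complex_of_real (F Z) * wigner h f g Z)
            / complex_of_real ((2 * pi * h) ^ DIM('a)))"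

end

theory Submission
  imports Defs "HOL-Probability.Probability"
begin

text \<open>By boundedness of the operator it suffices to treat finite combinations \<open>u\<close> of the wave packets
  \<open>exp (- |x|\<^sup>2 / 2h + i \<theta> \<bullet> x)\<close>, which are dense in \<open>L\<^sup>2\<close> and have Gaussian cross-Wigner functions.
  For the symbol \<open>exp (- s |Z|\<^sup>2 / h)\<close> the quadratic form of \<open>u\<close> equals
  \<open>\<Sum>N. P N * v ^ N / (1 + s) ^ d\<close> with \<open>v = 2 / (1 + s) - 1\<close>, where \<open>P N \<ge> 0\<close> (a Gram matrix raised
  entrywise to the power \<open>N\<close>) and \<open>\<Sum>N. P N = \<parallel>u\<parallel>\<^sup>2\<close>; \<open>P N\<close> is the weight of \<open>u\<close> on the \<open>N\<close>-th level of the
  harmonic oscillator. Since \<open>\<Phi>\<close> is nondecreasing and bounded, Bernstein polynomials approximate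
  \<open>\<Phi> t\<close> uniformly by \<open>q (exp (- t / h))\<close> with polynomials \<open>q\<close> that are nonincreasing on \<open>[0, 1]\<close>. This
  leaves, for each level \<open>N\<close>, an inequality that is linear in \<open>q\<close>; it follows from the positivity of
  partial sums of \<open>(-1)\<^sup>k L\<^sub>k (2 x\<^sup>2)\<close> (\<open>L\<^sub>k\<close> the Laguerre polynomials), which are sums of squares of
  Hermite polynomials.\<close>

section \<open>Laguerre eigenvalues of decreasing polynomials\<close>

text \<open>A monomial \<open>x ^ k\<close> of \<open>q\<close> is the symbol with s = k; put c = k
  + 1. On level N it has the eigenvalue \<open>v ^ N / c ^ d\<close> with v = 2 / c - 1, while its
  average against the exponential density is 1 / c. The gap is (v^N - 1) / c^d + (1 / c^d - 1 / c),
  and both parts contain the factor -(c - 1), the first because v - 1 = -2 (c - 1) / c. On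
  coefficients this factor turns q(x) into -x q'(x), which is where monotonicity enters. What is
  left is a geometric sum in v, divided by a power of c: a Laplace transform of the nonnegative
  Laguerre sums, up to averaging. The order of the limits is forced. A uniform bound on a symbol
  does not bound its Weyl operator, so \<Phi> cannot be approximated in operator norm. The symbol is
  replaced for one fixed \<open>u\<close>, whose cross-Wigner functions are integrable, and that
  error tends to 0 before \<open>u\<close> approaches \<open>f\<close>; the second limit uses only
  the boundedness of the given operator. Packets replace an eigenbasis: the levels appear as the
  terms of an exponential series, so no spectral decomposition has to be constructed.\<close>

fun hermite :: "nat \<Rightarrow> real poly" where
  "hermite 0 = 1"
| "hermite (Suc 0) = [:0, 2:]"
| "hermite (Suc (Suc n)) = [:0, 2:] * hermite (Suc n) - smult (2 * real (Suc n)) (hermite n)"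

text \<open>These are the physicists' Hermite polynomials. The induction is strong because
  differentiating the three-term recurrence involves the two preceding indices.\<close>

lemma pderiv_hermite_Suc: "pderiv (hermite (Suc n)) = smult (2 * real (Suc n)) (hermite n)"
proof (induction n rule: less_induct)
  case (less n)
  show ?case
  proof (cases n)
    case 0
    then show ?thesis by (simp add: pderiv_pCons one_pCons)
  next
    case (Suc m)
    \<comment> \<open>The truncated index \<open>m - 1\<close> is harmless at \<open>m = 0\<close>,
      since the factor \<open>real m\<close> vanishes there.\<close>
    have m: "pderiv (hermite m) = smult (2 * real m) (hermite (m - 1))"
      using less.IH[of "m - 1"] Suc by (cases m) (simp_all add: one_pCons)
    have n: "hermite n = [:0, 2:] * hermite m - smult (2 * real m) (hermite (m - 1))"
      using Suc by (cases m) simp_all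
    have dn: "pderiv (hermite n) = smult (2 * real n) (hermite m)"
      using less.IH[of m] Suc by simp
    have "pderiv (hermite (Suc n)) = pderiv ([:0, 2:] * hermite n) - smult (2 * real n) (pderiv (hermite m))"
      using Suc by (simp only: hermite.simps pderiv_diff pderiv_smult)
    also have "\<dots> = smult 2 (hermite n) + smult (2 * real n) ([:0, 2:] * hermite m - smult (2 * real m) (hermite (m - 1)))"
      unfolding m pderiv_mult dn by (simp add: pderiv_pCons smult_diff_right algebra_simps)
    also have "\<dots> = smult (2 * real (Suc n)) (hermite n)"
      unfolding n[symmetric] by (simp add: smult_add_left[symmetric] algebra_simps)
    finally show ?thesis .
  qed
qed

text \<open>By Mehler's formula on the diagonal, these are the coefficients of t^n in G = (1 -
  t^2)^(-1/2) exp (2 x^2 t / (1 + t)). The recurrences below are coefficient comparisons in G,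
  carried out on polynomials.\<close>

definition hermite_square :: "nat \<Rightarrow> real poly" where
  "hermite_square n = smult (1 / (2 ^ n * fact n)) ((hermite n)\<^sup>2)"

lemma pderiv_hermite_square_0 [simp]: "pderiv (hermite_square 0) = 0"
  by (simp add: hermite_square_def pderiv_1 power2_eq_square)

text \<open>Coefficient form of (1 + t) dG/dx = 4 x t G. On the polynomial side it follows from the
  derivative formula together with the three-term recurrence.\<close>

lemma pderiv_hermite_square_add:
  "pderiv (hermite_square (Suc n)) + pderiv (hermite_square n) = [:0, 4:] * hermite_square n"
proof (cases n)
  case 0
  then show ?thesis
    by (simp add: hermite_square_def pderiv_smult pderiv_mult power2_eq_square pderiv_pCons)
next
  case (Suc m)
  define c :: real where "c = 1 / (2 ^ n * fact n)"
  have deriv: "pderiv (hermite_square k) = smult (2 / (2 ^ k * fact k)) (hermite k * pderiv (hermite k))" for k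
  proof -
    have "pderiv ((hermite k)\<^sup>2) = 2 * (hermite k * pderiv (hermite k))"
      by (simp only: power2_eq_square pderiv_mult mult.commute mult_2)
    also have "\<dots> = smult 2 (hermite k * pderiv (hermite k))"
      by (simp add: numeral_poly)
    finally have "pderiv ((hermite k)\<^sup>2) = smult 2 (hermite k * pderiv (hermite k))" .
    then show ?thesis by (simp add: hermite_square_def pderiv_smult)
  qed
  have "2 / (2 ^ Suc n * fact (Suc n)) * (2 * real (Suc n)) = 2 * c"
    by (simp add: c_def divide_simps)
  then have "pderiv (hermite_square (Suc n)) = smult (2 * c) (hermite (Suc n) * hermite n)"
    unfolding deriv pderiv_hermite_Suc by (simp only: mult_smult_right smult_smult)
  moreover have "pderiv (hermite_square n) = smult (2 * c) (hermite n * smult (2 * real n) (hermite m))"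
    unfolding deriv Suc pderiv_hermite_Suc by (simp add: c_def Suc field_simps)
  ultimately have "pderiv (hermite_square (Suc n)) + pderiv (hermite_square n)
      = smult (2 * c) (hermite n * (hermite (Suc n) + smult (2 * real n) (hermite m)))"
    by (simp add: smult_add_right distrib_left mult.commute)
  also have "hermite (Suc n) + smult (2 * real n) (hermite m) = [:0, 2:] * hermite n"
    using Suc by simp
  finally show ?thesis
    by (simp add: hermite_square_def power2_eq_square c_def smult_add_right mult.commute)
qed

text \<open>As a function of \<open>x\<close> this is \<open>\<Sum>k\<le>n. (-1)\<^sup>k L\<^sub>k (2 x\<^sup>2)\<close>. Only its derivative recurrence and its
  values at \<open>0\<close> are needed to compute its Laplace transform.\<close>

definition mehler_sum :: "nat \<Rightarrow> real poly" where
  "mehler_sum n = (\<Sum>i\<le>n. smult (poly (hermite_square (n - i)) 0) (hermite_square i))"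

text \<open>The weights in the convolution are themselves nonnegative, being
  \<open>hermite_square\<close> at 0. The convolution multiplies Mehler's function by its value at x
  = 0, which yields exp (2 x^2 t / (1 + t)) / (1 - t^2). This is the generating function of (-1)^k
  L_k(2 x^2), namely exp (2 x^2 t / (1 + t)) / (1 + t), times the factor 1 / (1 - t) that forms
  partial sums.\<close>

lemma mehler_sum_nonneg: "0 \<le> poly (mehler_sum n) x"
  unfolding mehler_sum_def hermite_square_def
  by (auto simp: poly_sum intro!: sum_nonneg mult_nonneg_nonneg)

lemma pderiv_sum_smult: "pderiv (\<Sum>i\<in>I. smult (c i) (p i)) = (\<Sum>i\<in>I. smult (c i) (pderiv (p i)))"
  by (induction I rule: infinite_finite_induct) (simp_all add: pderiv_add pderiv_smult)

text \<open>Convolution with constants preserves the recurrence of \<open>hermite_square\<close>.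
  The index shift is free because the term i = 0 has derivative zero.\<close>

lemma pderiv_mehler_sum_add:
  "pderiv (mehler_sum (Suc n)) + pderiv (mehler_sum n) = [:0, 4:] * mehler_sum n"
proof -
  have "pderiv (mehler_sum (Suc n)) = (\<Sum>i\<le>n. smult (poly (hermite_square (n - i)) 0) (pderiv (hermite_square (Suc i))))"
    unfolding mehler_sum_def
    by (subst sum.atMost_Suc_shift) (simp add: pderiv_add pderiv_sum_smult pderiv_smult)
  moreover have "pderiv (mehler_sum n) = (\<Sum>i\<le>n. smult (poly (hermite_square (n - i)) 0) (pderiv (hermite_square i)))"
    unfolding mehler_sum_def by (rule pderiv_sum_smult)
  ultimately have "pderiv (mehler_sum (Suc n)) + pderiv (mehler_sum n) =
    (\<Sum>i\<le>n. smult (poly (hermite_square (n - i)) 0) (pderiv (hermite_square (Suc i)) + pderiv (hermite_square i)))"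
    by (simp add: sum.distrib smult_add_right)
  then show ?thesis
    by (simp only: pderiv_hermite_square_add mehler_sum_def sum_distrib_left mult_smult_right)
qed

lemma hermite_square_0_rec:
  "real (n + 2) * poly (hermite_square (n + 2)) 0 = real (n + 1) * poly (hermite_square n) 0"
proof -
  have "poly (hermite (n + 2)) 0 = - (2 * real (n + 1) * poly (hermite n) 0)" by simp
  then show ?thesis
    by (simp add: hermite_square_def power2_eq_square del: hermite.simps of_nat_Suc of_nat_add)
qed

text \<open>The values at 0 are the coefficients 1, 0, 1, 0, ... of 1 / (1 - t^2) = B^2, where B =
  (1 - t^2)^(-1/2). The fact \<open>weighted\<close> encodes (B^2)' = 2 B B', and \<open>rec\<close>
  encodes (1 - t^2) B' = t B.\<close>

lemma mehler_sum_0_rec: "poly (mehler_sum (n + 2)) 0 = poly (mehler_sum n) 0"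
proof -
  define b where "b n = poly (hermite_square n) 0" for n
  have conv: "poly (mehler_sum n) 0 = (\<Sum>i\<le>n. b i * b (n - i))" for n
    unfolding mehler_sum_def b_def by (simp add: poly_sum mult.commute)
  have weighted: "2 * (\<Sum>i\<le>n. real i * (b i * b (n - i))) = real n * (\<Sum>i\<le>n. b i * b (n - i))" for n
  proof -
    have "(\<Sum>i\<le>n. real i * (b i * b (n - i))) = (\<Sum>i\<le>n. real (n - i) * (b i * b (n - i)))"
      by (rule sum.reindex_bij_witness[where i="\<lambda>i. n - i" and j="\<lambda>i. n - i"]) auto
    then have "2 * (\<Sum>i\<le>n. real i * (b i * b (n - i))) = (\<Sum>i\<le>n. real i * (b i * b (n - i)) + real (n - i) * (b i * b (n - i)))"
      by (simp add: sum.distrib)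
    also have "\<dots> = (\<Sum>i\<le>n. real n * (b i * b (n - i)))"
      by (intro sum.cong) (auto simp: of_nat_diff algebra_simps)
    finally show ?thesis by (simp add: sum_distrib_left)
  qed
  have b1: "b (Suc 0) = 0" by (simp add: b_def hermite_square_def)
  have rec: "real (i + 2) * b (i + 2) = real (i + 1) * b i" for i
    unfolding b_def by (rule hermite_square_0_rec)
  have "real (n + 2) * poly (mehler_sum (n + 2)) 0 = 2 * (\<Sum>i\<le>Suc (Suc n). real i * (b i * b (n + 2 - i)))"
    using weighted[of "n + 2"] conv by simp
  \<comment> \<open>The terms i = 0 and i = 1 drop out: the first has weight 0, the second contains
    \<open>b (Suc 0) = 0\<close>.\<close>
  also have "\<dots> = 2 * (\<Sum>i\<le>n. (real (i + 2) * b (i + 2)) * b (n - i))"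
    by (simp add: sum.atMost_Suc_shift b1 del: sum.atMost_Suc) (simp add: algebra_simps)
  also have "\<dots> = 2 * (\<Sum>i\<le>n. real i * (b i * b (n - i))) + 2 * (\<Sum>i\<le>n. b i * b (n - i))"
    unfolding rec by (simp add: sum.distrib algebra_simps sum_distrib_left)
  also have "\<dots> = real (n + 2) * poly (mehler_sum n) 0"
    unfolding weighted conv by (simp add: algebra_simps)
  finally show ?thesis by simp
qed

lemma mehler_sum_0_add: "poly (mehler_sum (Suc n)) 0 + poly (mehler_sum n) 0 = 1"
proof (induction n)
  case 0
  show ?case by (simp add: mehler_sum_def hermite_square_def)
next
  case (Suc n)
  then show ?case using mehler_sum_0_rec[of n] by simp
qed

section \<open>Polynomials against Gaussians and their Laplace transforms\<close>

lemma integrable_poly_gaussian: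
  fixes p :: "real poly" and c :: real
  assumes "c > 0"
  shows "integrable lborel (\<lambda>x. poly p x * exp (- c * x\<^sup>2))"
proof -
  define \<sigma> where "\<sigma> = sqrt (1 / (2 * c))"
  have \<sigma>: "\<sigma> > 0" "\<sigma>\<^sup>2 = 1 / (2 * c)" using assms by (auto simp: \<sigma>_def)
  have "integrable lborel (\<lambda>x. x ^ k * exp (- c * x\<^sup>2))" for k
  proof -
    have "integrable lborel (\<lambda>x. sqrt (2 * pi * \<sigma>\<^sup>2) * (normal_density 0 \<sigma> x * (x - 0) ^ k))"
      using integrable_normal_moment[OF \<sigma>(1), of 0 k] by simp
    moreover have "sqrt (2 * pi * \<sigma>\<^sup>2) * (normal_density 0 \<sigma> x * (x - 0) ^ k) = x ^ k * exp (- c * x\<^sup>2)" for x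
      using \<sigma> assms by (simp add: normal_density_def)
    ultimately show ?thesis by (simp only:)
  qed
  then have "integrable lborel (\<lambda>x. \<Sum>k\<le>degree p. coeff p k * (x ^ k * exp (- c * x\<^sup>2)))"
    by auto
  then show ?thesis
    by (simp add: poly_altdef sum_distrib_right mult.assoc)
qed

lemma poly_gaussian_tendsto_0:
  fixes p :: "real poly" and c :: real
  assumes "c > (0::real)"
  shows "((\<lambda>x. poly p x * exp (- c * x\<^sup>2)) \<longlongrightarrow> 0) at_top"
proof -
  have "((\<lambda>x. x ^ k * exp (- c * x\<^sup>2)) \<longlongrightarrow> 0) at_top" for k
  proof (rule Lim_null_comparison)
    show "\<forall>\<^sub>F x in at_top. norm (x ^ k * exp (- c * x\<^sup>2)) \<le> x ^ k * exp (- c * x)"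
      using eventually_ge_at_top[of 1]
    proof eventually_elim
      case (elim x)
      then have "x \<le> x\<^sup>2" by (simp add: power2_eq_square)
      then show ?case using elim assms by (auto intro!: mult_left_mono)
    qed
    have "((\<lambda>x. (1/c) ^ k * ((c * x) ^ k / exp (c * x))) \<longlongrightarrow> (1/c) ^ k * 0) at_top"
      by (intro tendsto_intros filterlim_compose[OF tendsto_power_div_exp_0]
          filterlim_tendsto_pos_mult_at_top[OF tendsto_const assms] filterlim_ident)
    then show "((\<lambda>x. x ^ k * exp (- c * x)) \<longlongrightarrow> 0) at_top"
      using assms by (simp add: power_mult_distrib exp_minus field_simps power_divide)
  qed
  then have "((\<lambda>x. \<Sum>k\<le>degree p. coeff p k * (x ^ k * exp (- c * x\<^sup>2))) \<longlongrightarrow> (\<Sum>k\<le>degree p. coeff p k * 0)) at_top"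
    by (intro tendsto_intros)
  then show ?thesis
    by (simp add: poly_altdef sum_distrib_right mult.assoc)
qed

text \<open>Integrability is a hypothesis instead of a sign condition, because the integrands it is
  applied to are derivatives of polynomials times Gaussians and may change sign.\<close>

lemma set_integral_FTC_atLeast:
  fixes f F :: "real \<Rightarrow> real"
  assumes "\<And>x. x \<ge> a \<Longrightarrow> (F has_real_derivative f x) (at x)"
    and "\<And>x. x \<ge> a \<Longrightarrow> isCont f x"
    and "set_integrable lborel {a..} f"
    and "(F \<longlongrightarrow> l) at_top"
  shows "(LINT x:{a..}|lborel. f x) = l - F a"
proof (rule tendsto_unique)
  show "((\<lambda>b. LINT x:{a..b}|lborel. f x) \<longlongrightarrow> (LINT x:{a..}|lborel. f x)) at_top"
    by (rule tendsto_set_lebesgue_integral_at_top) (use assms in auto)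
  show "((\<lambda>b. LINT x:{a..b}|lborel. f x) \<longlongrightarrow> l - F a) at_top"
  proof (rule Lim_transform_eventually)
    show "((\<lambda>b. F b - F a) \<longlongrightarrow> l - F a) at_top" by (intro tendsto_intros assms)
    show "\<forall>\<^sub>F b in at_top. F b - F a = (LINT x:{a..b}|lborel. f x)"
      using eventually_ge_at_top[of a]
    proof eventually_elim
      case (elim b)
      have "(LINT x|lborel. f x * indicator {a..b} x) = F b - F a"
        using elim assms(1,2)
        by (intro integral_FTC_Icc_real)
           auto
      then show ?case by (simp add: set_lebesgue_integral_def mult.commute)
    qed
  qed
qed auto

lemma set_integrable_poly_gaussian:
  fixes p :: "real poly" and c :: real
  assumes "c > 0"
  shows "set_integrable lborel {0..} (\<lambda>x. poly p x * exp (- c * x\<^sup>2))"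
  unfolding set_integrable_def
  by (intro integrable_mult_indicator integrable_poly_gaussian assms) simp

text \<open>With y = x^2 this is the Laplace transform of the sum over k of (-1)^k L_k(2 y), each
  term contributing (2 / c - 1)^k / c. Integrating the derivative of p(x) exp (-c x^2) converts the
  derivative recurrence and the values at 0 into the recurrence L(n + 1) = (2 / c - 1) L(n) + 1 /
  c.\<close>

lemma laplace_mehler_sum:
  fixes c :: real
  assumes c: "c > 0"
  shows "(LINT x:{0..}|lborel. 2 * x * poly (mehler_sum n) x * exp (- c * x\<^sup>2)) = (\<Sum>k\<le>n. (2 / c - 1) ^ k) / c"
proof -
  define \<Lambda> where "\<Lambda> p = (LINT x:{0..}|lborel. poly p x * exp (- c * x\<^sup>2))" for p :: "real poly"
  have lin: "\<Lambda> (p + q) = \<Lambda> p + \<Lambda> q" "\<Lambda> (p - q) = \<Lambda> p - \<Lambda> q" "\<Lambda> (smult a p) = a * \<Lambda> p" for p q a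
    unfolding \<Lambda>_def poly_add poly_diff poly_smult distrib_right left_diff_distrib mult.assoc
    using set_integrable_poly_gaussian[OF c]
    by (simp_all add: set_integral_add set_integral_diff)
  have FTC: "\<Lambda> (pderiv p - smult c ([:0, 2:] * p)) = - poly p 0" for p
  proof -
    have "\<Lambda> (pderiv p - smult c ([:0, 2:] * p)) = 0 - poly p 0 * exp (- c * 0\<^sup>2)"
      unfolding \<Lambda>_def
    proof (rule set_integral_FTC_atLeast)
      show "((\<lambda>x. poly p x * exp (- c * x\<^sup>2)) has_real_derivative
              poly (pderiv p - smult c ([:0, 2:] * p)) x * exp (- c * x\<^sup>2)) (at x)" for x
        by (auto intro!: derivative_eq_intros simp: algebra_simps)
    qed (rule set_integrable_poly_gaussian[OF c] poly_gaussian_tendsto_0[OF c] continuous_intros)+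
    then show ?thesis by simp
  qed
  define L where "L n = \<Lambda> ([:0, 2:] * mehler_sum n)" for n
  have "L n = (\<Sum>k\<le>n. (2 / c - 1) ^ k) / c"
  proof (induction n)
    case 0
    have "c * L 0 = 1"
      using FTC[of 1] unfolding lin L_def
      by (simp add: mehler_sum_def hermite_square_def) (simp add: \<Lambda>_def)
    then show ?case using c by (simp add: field_simps)
  next
    case (Suc n)
    \<comment> \<open>Two consecutive polynomials are added because their sum has the known
      derivative 4 x \<open>mehler_sum n\<close> and the value 1 at 0.\<close>
    have "pderiv (mehler_sum (Suc n) + mehler_sum n) - smult c ([:0, 2:] * (mehler_sum (Suc n) + mehler_sum n))
       = smult 2 ([:0, 2:] * mehler_sum n) - smult c ([:0, 2:] * mehler_sum (Suc n) + [:0, 2:] * mehler_sum n)"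
      unfolding pderiv_add pderiv_mehler_sum_add distrib_left by simp
    then have "2 * L n - c * (L (Suc n) + L n) = - 1"
      using FTC[of "mehler_sum (Suc n) + mehler_sum n"] mehler_sum_0_add[of n]
      by (simp only: lin L_def poly_add)
    then have "L (Suc n) = (2 / c - 1) * L n + 1 / c"
      using c by (simp add: field_simps)
    also have "\<dots> = (\<Sum>k\<le>Suc n. (2 / c - 1) ^ k) / c"
      unfolding Suc by (subst sum.atMost_Suc_shift) (simp add: sum_distrib_left add_divide_distrib)
    finally show ?case .
  qed
  then show ?thesis
    by (simp add: L_def \<Lambda>_def mult.assoc mult.left_commute)
qed

text \<open>The weight is a function of \<open>c = k + 1\<close>, so that \<open>1 / c\<close> gives the integral of \<open>q\<close> over \<open>[0, 1]\<close> and
  multiplying a weight by \<open>1 / c\<close> corresponds to replacing \<open>q x\<close> by its average over \<open>[0, x]\<close>.\<close>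

definition coeff_pairing :: "(real \<Rightarrow> real) \<Rightarrow> real poly \<Rightarrow> real" where
  "coeff_pairing w q = (\<Sum>k\<le>degree q. coeff q k * w (real k + 1))"

text \<open>For c = k + 1 the Gaussian is exp (-x^2) times the k-th power of exp (-x^2). Summing
  over k reassembles p, and the pairing becomes the integral of 2 x \<open>mehler_sum n\<close> exp
  (-x^2) p(exp (-x^2)), with p evaluated only inside [0, 1].\<close>

lemma coeff_pairing_mehler_nonneg:
  assumes "\<And>x. 0 \<le> x \<Longrightarrow> x \<le> 1 \<Longrightarrow> 0 \<le> poly p x"
  shows "0 \<le> coeff_pairing (\<lambda>c. (\<Sum>k\<le>n. (2 / c - 1) ^ k) / c) p"
proof -
  let ?f = "\<lambda>x. 2 * x * poly (mehler_sum n) x * exp (- x\<^sup>2)"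
  have int: "set_integrable lborel {0..} (\<lambda>x. 2 * x * poly (mehler_sum n) x * exp (- (real k + 1) * x\<^sup>2))" for k
    using set_integrable_poly_gaussian[of "real k + 1" "[:0, 2:] * mehler_sum n"]
    by (simp add: mult_ac del: set_integrable_mult_right_iff set_integrable_mult_left_iff)
  have "coeff_pairing (\<lambda>c. (\<Sum>k\<le>n. (2 / c - 1) ^ k) / c) p =
     (\<Sum>k\<le>degree p. coeff p k * (LINT x:{0..}|lborel. 2 * x * poly (mehler_sum n) x * exp (- (real k + 1) * x\<^sup>2)))"
    unfolding coeff_pairing_def by (subst laplace_mehler_sum) auto
  also have "\<dots> = (LINT x:{0..}|lborel. \<Sum>k\<le>degree p. coeff p k * (2 * x * poly (mehler_sum n) x * exp (- (real k + 1) * x\<^sup>2)))"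
    using integrable_mult_right[OF int[unfolded set_integrable_def]]
    unfolding set_lebesgue_integral_def real_scaleR_def sum_distrib_left mult.left_commute[of "indicator _ _"]
    by (subst Bochner_Integration.integral_sum) (simp_all del: Bochner_Integration.integrable_mult_right_iff)
  also have "\<dots> = (LINT x:{0..}|lborel. ?f x * poly p (exp (- x\<^sup>2)))"
  proof (intro set_lebesgue_integral_cong ballI allI impI)
    fix x :: real
    have "exp (- (real k + 1) * x\<^sup>2) = exp (- x\<^sup>2) * exp (- x\<^sup>2) ^ k" for k
      by (simp add: exp_of_nat_mult[symmetric] mult_exp_exp algebra_simps)
    then show "(\<Sum>k\<le>degree p. coeff p k * (2 * x * poly (mehler_sum n) x * exp (- (real k + 1) * x\<^sup>2)))
       = ?f x * poly p (exp (- x\<^sup>2))"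
      by (simp add: poly_altdef[of p] sum_distrib_left mult_ac)
  qed auto
  also have "\<dots> \<ge> 0"
    unfolding set_lebesgue_integral_def
    by (intro Bochner_Integration.integral_nonneg) (auto simp: indicator_def mehler_sum_nonneg assms)
  finally show ?thesis .
qed

section \<open>Averages and the Euler operator on coefficients\<close>

definition poly_average :: "real poly \<Rightarrow> real poly" where
  "poly_average q = (\<Sum>k\<le>degree q. monom (coeff q k / (real k + 1)) k)"

lemma coeff_poly_average: "coeff (poly_average q) k = coeff q k / (real k + 1)"
  by (auto simp: poly_average_def coeff_sum coeff_eq_0)

lemma degree_poly_average: "degree (poly_average q) = degree q"
proof -
  have "degree (poly_average q) \<le> degree q"
    by (rule degree_le) (simp add: coeff_poly_average coeff_eq_0)
  moreover have "degree q \<le> degree (poly_average q)"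
  proof (rule degree_le, intro allI impI)
    fix i assume "degree (poly_average q) < i"
    then have "coeff (poly_average q) i = 0" by (rule coeff_eq_0)
    then show "coeff q i = 0" by (simp add: coeff_poly_average)
  qed
  ultimately show ?thesis by simp
qed

lemma coeff_pairing_poly_average:
  "coeff_pairing w (poly_average q) = coeff_pairing (\<lambda>c. w c / c) q"
  by (simp add: coeff_pairing_def degree_poly_average coeff_poly_average mult.commute)

text \<open>Multiplied by x, the average is the primitive of q that vanishes at 0, hence
  nondecreasing on [0, 1]. Division by x fails only at x = 0, where the average equals q(0).\<close>

lemma poly_average_nonneg:
  assumes q: "\<And>x. 0 \<le> x \<Longrightarrow> x \<le> 1 \<Longrightarrow> 0 \<le> poly q x" and x: "0 \<le> x" "x \<le> 1"
  shows "0 \<le> poly (poly_average q) x"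
proof (cases "x = 0")
  case True
  then show ?thesis using q[of 0] by (simp add: poly_0_coeff_0 coeff_poly_average)
next
  case False
  have "pderiv ([:0, 1:] * poly_average q) = q"
    by (rule poly_eqI) (simp add: coeff_pderiv coeff_poly_average add.commute)
  then have "((\<lambda>x. x * poly (poly_average q) x) has_real_derivative poly q y) (at y)" for y
    using poly_DERIV[of "[:0, 1:] * poly_average q" y] by simp
  then have "0 * poly (poly_average q) 0 \<le> x * poly (poly_average q) x"
    using q x by (intro DERIV_nonneg_imp_nondecreasing[of 0 x "\<lambda>x. x * poly (poly_average q) x"]) fastforce+
  then show ?thesis using False x by (simp add: zero_le_mult_iff)
qed

text \<open>Each further factor 1 / c is moved onto the polynomial by averaging it, which preserves
  nonnegativity; the induction therefore varies p.\<close>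

lemma coeff_pairing_mehler_power_nonneg:
  assumes "\<And>x. 0 \<le> x \<Longrightarrow> x \<le> 1 \<Longrightarrow> 0 \<le> poly p x"
  shows "0 \<le> coeff_pairing (\<lambda>c. (\<Sum>k\<le>n. (2 / c - 1) ^ k) / c ^ Suc j) p"
  using assms
proof (induction j arbitrary: p)
  case 0
  then show ?case using coeff_pairing_mehler_nonneg[of p n] by simp
next
  case (Suc j)
  have "0 \<le> coeff_pairing (\<lambda>c. (\<Sum>k\<le>n. (2 / c - 1) ^ k) / c ^ Suc j) (poly_average p)"
    by (rule Suc.IH) (use poly_average_nonneg Suc.prems in blast)
  then show ?case
    by (simp add: coeff_pairing_poly_average mult.commute mult.left_commute)
qed

text \<open>The operator x d/dx multiplies the k-th coefficient by k, which is c - 1. The minus sign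
  makes the transformed polynomial nonnegative on [0, 1] when q decreases there.\<close>

lemma coeff_pairing_euler:
  "coeff_pairing w ([:0, - 1:] * pderiv q) = coeff_pairing (\<lambda>c. - (c - 1) * w c) q"
proof -
  have c: "coeff ([:0, - 1:] * pderiv q) k = - real k * coeff q k" for k
    by (cases k) (simp_all add: coeff_pderiv algebra_simps)
  have "degree ([:0, - 1:] * pderiv q) \<le> degree q"
    by (rule degree_le) (auto simp: c coeff_eq_0 simp del: mult_pCons_left)
  then have "coeff_pairing w ([:0, - 1:] * pderiv q)
      = (\<Sum>k\<le>degree q. coeff ([:0, - 1:] * pderiv q) k * w (real k + 1))"
    unfolding coeff_pairing_def
    by (intro sum.mono_neutral_left) (auto simp: coeff_eq_0 simp del: mult_pCons_left)
  then show ?thesis by (simp only: c coeff_pairing_def) (simp add: mult_ac)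
qed

lemma coeff_pairing_add: "coeff_pairing (\<lambda>c. v c + w c) q = coeff_pairing v q + coeff_pairing w q"
  by (simp add: coeff_pairing_def distrib_left sum.distrib)

lemma coeff_pairing_sum: "coeff_pairing (\<lambda>c. \<Sum>i\<in>I. w i c) q = (\<Sum>i\<in>I. coeff_pairing (w i) q)"
  unfolding coeff_pairing_def sum_distrib_left by (rule sum.swap)

lemma coeff_pairing_cmult: "coeff_pairing (\<lambda>c. a * w c) q = a * coeff_pairing w q"
  by (simp add: coeff_pairing_def sum_distrib_left mult_ac)

lemma coeff_pairing_cong:
  "(\<And>c. c \<ge> 1 \<Longrightarrow> v c = w c) \<Longrightarrow> coeff_pairing v q = coeff_pairing w q"
  by (simp add: coeff_pairing_def)

text \<open>The right side is the eigenvalue on level N, in dimension d, of the symbol q(exp (-|Z|^2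
  / h)); the left side is the integral of q over [0, 1]. The two agree for N = 0 and d = 1. The
  facts \<open>first\<close> and \<open>second\<close> pass from level N to level 0 and from
  dimension d to dimension 1.\<close>

lemma laguerre_eigenvalue_ge:
  assumes decr: "\<And>x. 0 \<le> x \<Longrightarrow> x \<le> 1 \<Longrightarrow> poly (pderiv q) x \<le> 0" and "d \<ge> 1"
  shows "coeff_pairing (\<lambda>c. 1 / c) q \<le> coeff_pairing (\<lambda>c. (2 / c - 1) ^ N / c ^ d) q"
proof -
  define p where "p = [:0, - 1:] * pderiv q"
  have p: "0 \<le> poly p x" if "0 \<le> x" "x \<le> 1" for x
    using decr[OF that] that by (simp add: p_def mult_nonneg_nonpos)
  have first: "0 \<le> coeff_pairing (\<lambda>c. ((2 / c - 1) ^ N - 1) / c ^ d) q"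
  proof (cases N)
    case 0
    then show ?thesis by (simp add: coeff_pairing_def)
  next
    case (Suc n)
    have "coeff_pairing (\<lambda>c. ((2 / c - 1) ^ N - 1) / c ^ d) q
       = coeff_pairing (\<lambda>c. 2 * (- (c - 1) * ((\<Sum>k\<le>n. (2 / c - 1) ^ k) / c ^ Suc d))) q"
    proof (rule coeff_pairing_cong)
      fix c :: real assume c: "c \<ge> 1"
      have "(2 / c - 1) ^ N - 1 = (2 / c - 1 - 1) * (\<Sum>k\<le>n. (2 / c - 1) ^ k)"
        using power_diff_1_eq[of "2 / c - 1" N] Suc by (simp add: lessThan_Suc_atMost)
      also have "2 / c - 1 - 1 = - 2 * (c - 1) / c"
        using c by (simp add: field_simps)
      finally show "((2 / c - 1) ^ N - 1) / c ^ d = 2 * (- (c - 1) * ((\<Sum>k\<le>n. (2 / c - 1) ^ k) / c ^ Suc d))"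
        by simp
    qed
    also have "\<dots> \<ge> 0"
      unfolding coeff_pairing_cmult coeff_pairing_euler[symmetric] p_def[symmetric]
      by (intro mult_nonneg_nonneg coeff_pairing_mehler_power_nonneg p) auto
    finally show ?thesis .
  qed
  \<comment> \<open>A second geometric sum, now in 1 / c; it is empty for d = 1.\<close>
  have "coeff_pairing (\<lambda>c. 1 / c ^ d - 1 / c) q
     = coeff_pairing (\<lambda>c. \<Sum>m<d-1. - (c - 1) * (1 / c ^ Suc (Suc m))) q"
  proof (rule coeff_pairing_cong)
    fix c :: real assume c: "c \<ge> 1"
    have "1 / c ^ d - 1 / c = 1 / c * ((1 / c) ^ (d - 1) - 1)"
      using assms(2) by (cases d) (simp_all add: power_one_over right_diff_distrib)
    also have "\<dots> = 1 / c * ((1 / c - 1) * (\<Sum>m<d-1. (1 / c) ^ m))"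
      by (simp only: power_diff_1_eq)
    also have "\<dots> = (\<Sum>m<d-1. - (c - 1) * (1 / c ^ Suc (Suc m)))"
      unfolding sum_distrib_left using c by (intro sum.cong) (auto simp: field_simps)
    finally show "1 / c ^ d - 1 / c = (\<Sum>m<d-1. - (c - 1) * (1 / c ^ Suc (Suc m)))" .
  qed
  also have "\<dots> \<ge> 0"
    unfolding coeff_pairing_sum coeff_pairing_euler[symmetric] p_def[symmetric]
  proof (rule sum_nonneg)
    fix m
    show "0 \<le> coeff_pairing (\<lambda>c. 1 / c ^ Suc (Suc m)) p"
      \<comment> \<open>For \<open>n = 0\<close> the sum over powers of v is 1, so the weight
        reduces to a plain power of 1 / c.\<close>
      using coeff_pairing_mehler_power_nonneg[OF p, where n=0 and j="Suc m"] by simp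
  qed
  finally have second: "0 \<le> coeff_pairing (\<lambda>c. 1 / c ^ d - 1 / c) q" .
  have "coeff_pairing (\<lambda>c. (2 / c - 1) ^ N / c ^ d) q = coeff_pairing (\<lambda>c. 1 / c
     + (((2 / c - 1) ^ N - 1) / c ^ d + (1 / c ^ d - 1 / c))) q"
    by (rule coeff_pairing_cong) (simp add: diff_divide_distrib)
  then show ?thesis unfolding coeff_pairing_add using first second by simp
qed

section \<open>Gaussian integrals and Wigner functions of wave packets\<close>

lemma lborel_integral_prod_Basis:
  fixes f :: "'a::euclidean_space \<Rightarrow> real \<Rightarrow> complex"
  assumes f: "\<And>b. b \<in> Basis \<Longrightarrow> integrable lborel (f b)"
  shows "integrable lborel (\<lambda>x. \<Prod>b\<in>Basis. f b (x \<bullet> b))" (is ?I)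
    and "(LINT x|lborel. (\<Prod>b\<in>Basis. f b (x \<bullet> b))) = (\<Prod>b\<in>Basis. (LINT y|lborel. f b y))" (is ?E)
proof -
  interpret product_sigma_finite "\<lambda>b::'a. lborel :: real measure" ..
  have [measurable]: "f b \<in> borel_measurable borel" if "b \<in> Basis" for b
    using borel_measurable_integrable[OF f[OF that]] by simp
  have [measurable]: "(\<lambda>x. \<Prod>b\<in>Basis. f b (x \<bullet> b)) \<in> borel_measurable borel"
    by measurable
  have inner: "(\<Sum>b\<in>Basis. y b *\<^sub>R b) \<bullet> b' = y b'" if "b' \<in> Basis" for y and b' :: 'a
    using that by (simp add: inner_sum_left_Basis)
  show ?I
    by (subst lborel_eq, subst integrable_distr_eq)
       (auto simp: inner intro!: product_integrable_prod f cong: prod.cong)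
  show ?E
    by (subst lborel_eq, subst integral_distr)
       (auto simp: inner intro!: product_integral_prod f cong: prod.cong)
qed

text \<open>Rescaling by c = sqrt (2 \<alpha>) reduces both claims to the characteristic function of
  the standard normal distribution.\<close>

lemma fourier_gaussian_real:
  assumes \<alpha>: "\<alpha> > 0"
  shows "integrable lborel (\<lambda>x::real. complex_of_real (exp (- \<alpha> * x\<^sup>2)) * cis (\<theta> * x))"
    and "(LINT x|lborel. complex_of_real (exp (- \<alpha> * x\<^sup>2)) * cis (\<theta> * x)) =
           complex_of_real (sqrt (pi / \<alpha>) * exp (- \<theta>\<^sup>2 / (4 * \<alpha>)))"
proof -
  define c where "c = sqrt (2 * \<alpha>)"
  have c: "c > 0" "c\<^sup>2 = 2 * \<alpha>" using \<alpha> by (auto simp: c_def)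
  let ?g = "\<lambda>y. complex_of_real (std_normal_density y) * cis (\<theta> / c * y)"
  have eq: "complex_of_real (exp (- \<alpha> * x\<^sup>2)) * cis (\<theta> * x) = complex_of_real (sqrt (2 * pi)) * ?g (0 + c * x)" for x
    using c by (simp add: normal_density_def power_mult_distrib of_real_mult[symmetric] del: of_real_mult)
  have int: "integrable lborel ?g"
  proof (rule Bochner_Integration.integrable_bound)
    show "integrable lborel std_normal_density" by simp
    show "?g \<in> borel_measurable lborel" by (simp add: cis_conv_exp)
  qed (auto simp: norm_mult)
  have "char std_normal_distribution (\<theta> / c) = (LINT y|lborel. ?g y)"
    unfolding char_def
    by (subst integral_density) (auto simp: scaleR_conv_of_real cis_conv_exp mult_ac)
  then have char: "(LINT y|lborel. ?g y) = complex_of_real (exp (- (\<theta> / c)\<^sup>2 / 2))"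
    by (simp add: char_std_normal_distribution)
  show "integrable lborel (\<lambda>x::real. complex_of_real (exp (- \<alpha> * x\<^sup>2)) * cis (\<theta> * x))"
    unfolding eq using lborel_integrable_real_affine[OF int, of c 0] c by simp
  have "(LINT x|lborel. complex_of_real (exp (- \<alpha> * x\<^sup>2)) * cis (\<theta> * x)) = complex_of_real (sqrt (2 * pi)) * (LINT x|lborel. ?g (0 + c * x))"
    unfolding eq by simp
  also have "(LINT x|lborel. ?g (0 + c * x)) = complex_of_real (1 / c) * (LINT y|lborel. ?g y)"
    using lborel_integral_real_affine[of c ?g 0] c by (simp add: scaleR_conv_of_real field_simps)
  also have "complex_of_real (sqrt (2 * pi)) * (complex_of_real (1 / c) * (LINT y|lborel. ?g y))
     = complex_of_real (sqrt (2 * pi) / c * exp (- (\<theta> / c)\<^sup>2 / 2))"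
    unfolding char by simp
  also have "sqrt (2 * pi) / c = sqrt (pi / \<alpha>)"
    using \<alpha> by (simp add: c_def real_sqrt_divide real_sqrt_mult)
  also have "- (\<theta> / c)\<^sup>2 / 2 = - \<theta>\<^sup>2 / (4 * \<alpha>)"
    using c \<alpha> by (simp add: power_divide)
  finally show "(LINT x|lborel. complex_of_real (exp (- \<alpha> * x\<^sup>2)) * cis (\<theta> * x)) =
           complex_of_real (sqrt (pi / \<alpha>) * exp (- \<theta>\<^sup>2 / (4 * \<alpha>)))" .
qed

lemma power2_norm_eq_sum_Basis: "(norm (x::'a::euclidean_space))\<^sup>2 = (\<Sum>b\<in>Basis. (x \<bullet> b)\<^sup>2)"
  unfolding power2_norm_eq_inner euclidean_inner[of x x] by (simp add: power2_eq_square)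

lemma cis_sum: "finite I \<Longrightarrow> cis (\<Sum>i\<in>I. f i) = (\<Prod>i\<in>I. cis (f i))"
  by (induction I rule: finite_induct) (simp_all add: cis_mult[symmetric])

lemma fourier_gaussian:
  fixes \<theta> :: "'a::euclidean_space"
  assumes \<alpha>: "\<alpha> > 0"
  shows "integrable lborel (\<lambda>x. complex_of_real (exp (- \<alpha> * (norm x)\<^sup>2)) * cis (\<theta> \<bullet> x))"
    and "(LINT x|lborel. complex_of_real (exp (- \<alpha> * (norm x)\<^sup>2)) * cis (\<theta> \<bullet> x)) =
           complex_of_real (sqrt (pi / \<alpha>) ^ DIM('a) * exp (- (norm \<theta>)\<^sup>2 / (4 * \<alpha>)))"
proof -
  have eq: "complex_of_real (exp (- \<alpha> * (norm x)\<^sup>2)) * cis (\<theta> \<bullet> x) =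
     (\<Prod>b\<in>Basis. complex_of_real (exp (- \<alpha> * (x \<bullet> b)\<^sup>2)) * cis (\<theta> \<bullet> b * (x \<bullet> b)))" for x
    unfolding power2_norm_eq_sum_Basis euclidean_inner[of \<theta> x]
    by (simp add: prod.distrib cis_sum exp_sum sum_negf[symmetric] sum_distrib_left del: sum_negf)
  show "integrable lborel (\<lambda>x. complex_of_real (exp (- \<alpha> * (norm x)\<^sup>2)) * cis (\<theta> \<bullet> x))"
    unfolding eq by (intro lborel_integral_prod_Basis fourier_gaussian_real \<alpha>)
  have "(LINT x|lborel. complex_of_real (exp (- \<alpha> * (norm x)\<^sup>2)) * cis (\<theta> \<bullet> x)) =
    (\<Prod>b\<in>(Basis::'a set). complex_of_real (sqrt (pi / \<alpha>) * exp (- (\<theta> \<bullet> b)\<^sup>2 / (4 * \<alpha>))))"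
    unfolding eq
    by (subst lborel_integral_prod_Basis(2)) (simp_all only: fourier_gaussian_real[OF \<alpha>])
  also have "\<dots> = complex_of_real (sqrt (pi / \<alpha>) ^ DIM('a) * exp (- (norm \<theta>)\<^sup>2 / (4 * \<alpha>)))"
    unfolding power2_norm_eq_sum_Basis
    by (simp add: prod.distrib exp_sum[symmetric] sum_negf sum_divide_distrib of_real_prod[symmetric] del: of_real_prod)
  finally show "(LINT x|lborel. complex_of_real (exp (- \<alpha> * (norm x)\<^sup>2)) * cis (\<theta> \<bullet> x)) =
           complex_of_real (sqrt (pi / \<alpha>) ^ DIM('a) * exp (- (norm \<theta>)\<^sup>2 / (4 * \<alpha>)))" .
qed

lemma gaussian_shifted:
  fixes c :: "'a::euclidean_space"
  assumes \<alpha>: "\<alpha> > 0"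
  shows "integrable lborel (\<lambda>x. complex_of_real (exp (- \<alpha> * (norm (x - c))\<^sup>2)))"
    and "(LINT x|lborel. complex_of_real (exp (- \<alpha> * (norm (x - c))\<^sup>2))) = complex_of_real (sqrt (pi / \<alpha>) ^ DIM('a))"
proof -
  have "integrable (distr lborel borel ((+) (- c))) (\<lambda>x. complex_of_real (exp (- \<alpha> * (norm x)\<^sup>2)))"
    unfolding lborel_distr_plus using fourier_gaussian(1)[OF \<alpha>, of "0::'a"] by simp
  then show "integrable lborel (\<lambda>x. complex_of_real (exp (- \<alpha> * (norm (x - c))\<^sup>2)))"
    by (subst (asm) integrable_distr_eq) auto
  have "(LINT x|lborel. complex_of_real (exp (- \<alpha> * (norm (x - c))\<^sup>2))) = (LINT x|distr lborel borel ((+) (- c)). complex_of_real (exp (- \<alpha> * (norm x)\<^sup>2)))"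
    by (subst integral_distr) auto
  then show "(LINT x|lborel. complex_of_real (exp (- \<alpha> * (norm (x - c))\<^sup>2))) = complex_of_real (sqrt (pi / \<alpha>) ^ DIM('a))"
    unfolding lborel_distr_plus using fourier_gaussian(2)[OF \<alpha>, of "0::'a"] by simp
qed

lemma lborel_integral_tensor:
  fixes f :: "'a::euclidean_space \<Rightarrow> complex" and g :: "'b::euclidean_space \<Rightarrow> complex"
  assumes f: "integrable lborel f" and g: "integrable lborel g"
  shows "integrable lborel (\<lambda>(x, y). f x * g y)"
    and "(LINT (x, y)|lborel. f x * g y) = (LINT x|lborel. f x) * (LINT y|lborel. g y)"
proof -
  have [measurable]: "f \<in> borel_measurable borel" "g \<in> borel_measurable borel"
    using borel_measurable_integrable[OF f] borel_measurable_integrable[OF g] by simp_all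
  have int: "integrable (lborel \<Otimes>\<^sub>M lborel) (\<lambda>(x, y). f x * g y)"
    by (rule lborel_pair.Fubini_integrable) (use f g in \<open>auto simp: norm_mult\<close>)
  then show "integrable lborel (\<lambda>(x, y). f x * g y)" by (simp add: lborel_prod)
  have "(LINT (x, y)|(lborel \<Otimes>\<^sub>M lborel). f x * g y) = (LINT x|lborel. LINT y|lborel. f x * g y)"
    using lborel_pair.integral_fst'[OF int] by simp
  then show "(LINT (x, y)|lborel. f x * g y) = (LINT x|lborel. f x) * (LINT y|lborel. g y)"
    using f g by (simp add: lborel_prod)
qed

section \<open>Wave packets, their Wigner functions and inner products\<close>

definition wave_packet :: "real \<Rightarrow> 'a::euclidean_space \<Rightarrow> 'a \<Rightarrow> complex" where
  "wave_packet h \<theta> x = complex_of_real (exp (- (norm x)\<^sup>2 / (2 * h))) * cis (\<theta> \<bullet> x)"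

text \<open>The parallelogram law separates z from t in the Gaussians. The t-integral is then the
  Fourier transform of exp (-|t|^2 / (4 h)), a Gaussian in \<zeta> centred at h times the mean of
  the two frequencies. The width of the packet is chosen so that both variables decay at the same
  rate 1 / h, matching the radial symbols.\<close>

lemma wigner_wave_packet:
  fixes \<theta> \<theta>' :: "'a::euclidean_space"
  assumes h: "h > 0"
  shows "wigner h (wave_packet h \<theta>) (wave_packet h \<theta>') (z, \<zeta>) =
    complex_of_real (sqrt (4 * pi * h) ^ DIM('a)) *
      ((complex_of_real (exp (- (norm z)\<^sup>2 / h)) * cis ((\<theta> - \<theta>') \<bullet> z)) *
       complex_of_real (exp (- (norm (\<zeta> - (h / 2) *\<^sub>R (\<theta> + \<theta>')))\<^sup>2 / h)))"
proof -
  \<comment> \<open>This is the total frequency in t: half of each packet frequency, because the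
    arguments move by t / 2, minus \<zeta> / h from the kernel.\<close>
  define w where "w = (1 / 2) *\<^sub>R (\<theta> + \<theta>') - (1 / h) *\<^sub>R \<zeta>"
  have par: "(norm (z + t /\<^sub>R 2))\<^sup>2 + (norm (z - t /\<^sub>R 2))\<^sup>2 = 2 * (norm z)\<^sup>2 + (norm t)\<^sup>2 / 2" for t
    by (simp add: power2_norm_eq_inner inner_add_left inner_diff_left inner_add_right inner_diff_right inner_commute field_simps)
  have "exp (- (\<i> / complex_of_real h) * complex_of_real (t \<bullet> \<zeta>)) * wave_packet h \<theta> (z + t /\<^sub>R 2) * cnj (wave_packet h \<theta>' (z - t /\<^sub>R 2))
    = (complex_of_real (exp (- (norm z)\<^sup>2 / h)) * cis ((\<theta> - \<theta>') \<bullet> z)) *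
      (complex_of_real (exp (- (1 / (4 * h)) * (norm t)\<^sup>2)) * cis (w \<bullet> t))" (is "?l t = ?r t") for t
  proof -
    have "exp (- (\<i> / complex_of_real h) * complex_of_real (t \<bullet> \<zeta>)) = cis (- (t \<bullet> \<zeta>) / h)"
      by (simp add: cis_conv_exp)
    then have "?l t = complex_of_real (exp (- (norm (z + t /\<^sub>R 2))\<^sup>2 / (2 * h)) * exp (- (norm (z - t /\<^sub>R 2))\<^sup>2 / (2 * h)))
       * (cis (- (t \<bullet> \<zeta>) / h) * cis (\<theta> \<bullet> (z + t /\<^sub>R 2)) * cis (- (\<theta>' \<bullet> (z - t /\<^sub>R 2))))"
      by (simp add: wave_packet_def cis_cnj mult_ac)
    also have "exp (- (norm (z + t /\<^sub>R 2))\<^sup>2 / (2 * h)) * exp (- (norm (z - t /\<^sub>R 2))\<^sup>2 / (2 * h))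
       = exp (- ((norm (z + t /\<^sub>R 2))\<^sup>2 + (norm (z - t /\<^sub>R 2))\<^sup>2) / (2 * h))"
      by (simp add: mult_exp_exp add_divide_distrib diff_divide_distrib)
    also have "\<dots> = exp (- (norm z)\<^sup>2 / h) * exp (- (1 / (4 * h)) * (norm t)\<^sup>2)"
      unfolding par using h by (simp add: mult_exp_exp field_simps)
    also have "cis (- (t \<bullet> \<zeta>) / h) * cis (\<theta> \<bullet> (z + t /\<^sub>R 2)) * cis (- (\<theta>' \<bullet> (z - t /\<^sub>R 2)))
       = cis ((\<theta> - \<theta>') \<bullet> z) * cis (w \<bullet> t)"
    proof -
      have "- (t \<bullet> \<zeta>) / h + \<theta> \<bullet> (z + t /\<^sub>R 2) + - (\<theta>' \<bullet> (z - t /\<^sub>R 2)) = (\<theta> - \<theta>') \<bullet> z + w \<bullet> t"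
        using h by (simp add: w_def inner_simps inner_commute)
      then show ?thesis by (simp only: cis_mult)
    qed
    finally show ?thesis by (simp add: mult_ac)
  qed
  then have "wigner h (wave_packet h \<theta>) (wave_packet h \<theta>') (z, \<zeta>) =
    (complex_of_real (exp (- (norm z)\<^sup>2 / h)) * cis ((\<theta> - \<theta>') \<bullet> z)) *
      complex_of_real (sqrt (pi / (1 / (4 * h))) ^ DIM('a) * exp (- (norm w)\<^sup>2 / (4 * (1 / (4 * h)))))"
    unfolding wigner_def
    by (subst fourier_gaussian(2)[symmetric]) (use h in simp_all)
  moreover have "(norm w)\<^sup>2 / (4 * (1 / (4 * h))) = (norm (\<zeta> - (h / 2) *\<^sub>R (\<theta> + \<theta>')))\<^sup>2 / h"
  proof -
    have "\<zeta> - (h / 2) *\<^sub>R (\<theta> + \<theta>') = - h *\<^sub>R w"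
      using h by (simp add: w_def algebra_simps)
    then show ?thesis using h by (simp add: power_mult_distrib power2_eq_square)
  qed
  ultimately show ?thesis by (simp add: mult_ac)
qed

lemma integrable_wigner_wave_packet:
  fixes \<theta> \<theta>' :: "'a::euclidean_space"
  assumes h: "h > 0"
  shows "integrable lborel (wigner h (wave_packet h \<theta>) (wave_packet h \<theta>'))"
proof -
  have "integrable lborel (\<lambda>(z, \<zeta>). 
      (complex_of_real (exp (- (1 / h) * (norm z)\<^sup>2)) * cis ((\<theta> - \<theta>') \<bullet> z)) *
       complex_of_real (exp (- (1 / h) * (norm (\<zeta> - (h / 2) *\<^sub>R (\<theta> + \<theta>')))\<^sup>2)))"
    using h by (intro lborel_integral_tensor fourier_gaussian gaussian_shifted) auto
  then have "integrable lborel (\<lambda>Z. complex_of_real (sqrt (4 * pi * h) ^ DIM('a)) * (case Z of (z, \<zeta>) \<Rightarrow>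
      (complex_of_real (exp (- (1 / h) * (norm z)\<^sup>2)) * cis ((\<theta> - \<theta>') \<bullet> z)) *
       complex_of_real (exp (- (1 / h) * (norm (\<zeta> - (h / 2) *\<^sub>R (\<theta> + \<theta>')))\<^sup>2))))"
    by (rule integrable_mult_right)
  also have "(\<lambda>Z. complex_of_real (sqrt (4 * pi * h) ^ DIM('a)) * (case Z of (z, \<zeta>) \<Rightarrow>
      (complex_of_real (exp (- (1 / h) * (norm z)\<^sup>2)) * cis ((\<theta> - \<theta>') \<bullet> z)) *
       complex_of_real (exp (- (1 / h) * (norm (\<zeta> - (h / 2) *\<^sub>R (\<theta> + \<theta>')))\<^sup>2))))
     = wigner h (wave_packet h \<theta>) (wave_packet h \<theta>')"
    by (auto simp: fun_eq_iff wigner_wave_packet[OF h])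
  finally show ?thesis .
qed

text \<open>Symbol and Wigner function merge into Gaussians of rate (1 + s) / h in z and \<zeta>, so
  the integral is explicit. In the exponent only the coefficient of \<theta> \<bullet> \<theta>'
  depends on s. The remaining exponential splits into one factor per packet, which can be absorbed
  into the coefficients of a linear combination.\<close>

lemma gaussian_weyl_wave_packet:
  fixes \<theta> \<theta>' :: "'a::euclidean_space"
  assumes h: "h > 0" and s: "s \<ge> 0"
  shows "(LINT Z|lborel. complex_of_real (exp (- s * (norm Z)\<^sup>2 / h)) * wigner h (wave_packet h \<theta>) (wave_packet h \<theta>') Z)
      / complex_of_real ((2 * pi * h) ^ DIM('a)) =
    complex_of_real (sqrt (pi * h) ^ DIM('a) * exp (- h / 4 * ((norm \<theta>)\<^sup>2 + (norm \<theta>')\<^sup>2))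
      * (exp (h / 2 * (2 / (1 + s) - 1) * (\<theta> \<bullet> \<theta>')) / (1 + s) ^ DIM('a)))"
proof -
  define \<alpha> where "\<alpha> = (1 + s) / h"
  define w where "w = (1 / 2) *\<^sub>R (\<theta> + \<theta>')"
  \<comment> \<open>The constant left over when the square in \<zeta> is completed.\<close>
  define E where "E = (norm w)\<^sup>2 / \<alpha> - h * (norm w)\<^sup>2"
  have \<alpha>: "\<alpha> > 0" using h s by (simp add: \<alpha>_def)
  have square: "- s * (norm \<zeta>)\<^sup>2 / h - (norm (\<zeta> - (h / 2) *\<^sub>R (\<theta> + \<theta>')))\<^sup>2 / h
    = - \<alpha> * (norm (\<zeta> - (1 / \<alpha>) *\<^sub>R w))\<^sup>2 + E" for \<zeta> :: 'a
  proof -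
    have "(h / 2) *\<^sub>R (\<theta> + \<theta>') = h *\<^sub>R w" by (simp add: w_def)
    then have "- s * (norm \<zeta>)\<^sup>2 / h - (norm (\<zeta> - (h / 2) *\<^sub>R (\<theta> + \<theta>')))\<^sup>2 / h
       = - s * (\<zeta> \<bullet> \<zeta>) / h - (\<zeta> \<bullet> \<zeta> - 2 * h * (\<zeta> \<bullet> w) + h * h * (w \<bullet> w)) / h"
      by (simp add: power2_norm_eq_inner inner_simps inner_commute algebra_simps)
    also have "\<dots> = - \<alpha> * (\<zeta> \<bullet> \<zeta>) + 2 * (\<zeta> \<bullet> w) - h * (w \<bullet> w)"
      using h by (simp add: \<alpha>_def field_simps)
    also have "\<dots> = - \<alpha> * (\<zeta> \<bullet> \<zeta> - 2 / \<alpha> * (\<zeta> \<bullet> w) + (w \<bullet> w) / \<alpha>\<^sup>2) + ((w \<bullet> w) / \<alpha> - h * (w \<bullet> w))"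
      using \<alpha> by (simp add: field_simps power2_eq_square)
    also have "\<dots> = - \<alpha> * (norm (\<zeta> - (1 / \<alpha>) *\<^sub>R w))\<^sup>2 + E"
      unfolding E_def power2_norm_eq_inner by (simp add: inner_simps inner_commute power2_eq_square)
    finally show ?thesis .
  qed
  let ?f = "\<lambda>z. complex_of_real (exp (- \<alpha> * (norm z)\<^sup>2)) * cis ((\<theta> - \<theta>') \<bullet> z)"
  let ?g = "\<lambda>\<zeta>. complex_of_real (exp (- \<alpha> * (norm (\<zeta> - (1 / \<alpha>) *\<^sub>R w))\<^sup>2))"
  have "complex_of_real (exp (- s * (norm (z, \<zeta>))\<^sup>2 / h)) * wigner h (wave_packet h \<theta>) (wave_packet h \<theta>') (z, \<zeta>)
     = complex_of_real (sqrt (4 * pi * h) ^ DIM('a) * exp E) * (?f z * ?g \<zeta>)" for z \<zeta> :: 'a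
  proof -
    have norm_pair: "- s * (norm (z, \<zeta>))\<^sup>2 / h = - s * (norm z)\<^sup>2 / h + - s * (norm \<zeta>)\<^sup>2 / h"
      unfolding add_divide_distrib[symmetric] by (simp add: norm_Pair algebra_simps)
    have "exp (- s * (norm (z, \<zeta>))\<^sup>2 / h) * (exp (- (norm z)\<^sup>2 / h) * exp (- (norm (\<zeta> - (h / 2) *\<^sub>R (\<theta> + \<theta>')))\<^sup>2 / h))
      = exp (- \<alpha> * (norm z)\<^sup>2) * exp (- s * (norm \<zeta>)\<^sup>2 / h - (norm (\<zeta> - (h / 2) *\<^sub>R (\<theta> + \<theta>')))\<^sup>2 / h)"
      unfolding norm_pair mult_exp_exp using h by (simp add: \<alpha>_def field_simps)
    also have "\<dots> = exp E * (exp (- \<alpha> * (norm z)\<^sup>2) * exp (- \<alpha> * (norm (\<zeta> - (1 / \<alpha>) *\<^sub>R w))\<^sup>2))"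
      unfolding square exp_add by simp
    finally have "complex_of_real (exp (- s * (norm (z, \<zeta>))\<^sup>2 / h)) *
        (complex_of_real (exp (- (norm z)\<^sup>2 / h)) * complex_of_real (exp (- (norm (\<zeta> - (h / 2) *\<^sub>R (\<theta> + \<theta>')))\<^sup>2 / h)))
      = complex_of_real (exp E) * (complex_of_real (exp (- \<alpha> * (norm z)\<^sup>2)) * ?g \<zeta>)"
      by (simp only: of_real_mult[symmetric])
    moreover have "a * (K * ((p * c) * q)) = (K * e) * ((u * c) * v)"
      if "a * (p * q) = e * (u * v)" for a K p c q e u v :: complex
    proof -
      have "a * (K * ((p * c) * q)) = K * c * (a * (p * q))" by (simp add: mult_ac)
      also have "\<dots> = (K * e) * ((u * c) * v)" unfolding that by (simp add: mult_ac)
      finally show ?thesis .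
    qed
    ultimately show ?thesis
      unfolding wigner_wave_packet[OF h] of_real_mult by blast
  qed
  then have "(LINT Z|lborel. complex_of_real (exp (- s * (norm Z)\<^sup>2 / h)) * wigner h (wave_packet h \<theta>) (wave_packet h \<theta>') Z)
     = (LINT Z|lborel. complex_of_real (sqrt (4 * pi * h) ^ DIM('a) * exp E) * (case Z of (z, \<zeta>) \<Rightarrow> ?f z * ?g \<zeta>))"
    by (intro Bochner_Integration.integral_cong refl) auto
  also have "\<dots> = complex_of_real (sqrt (4 * pi * h) ^ DIM('a) * exp E) * ((LINT z|lborel. ?f z) * (LINT \<zeta>|lborel. ?g \<zeta>))"
    by (simp only: integral_mult_right_zero lborel_integral_tensor(2)[OF fourier_gaussian(1)[OF \<alpha>] gaussian_shifted(1)[OF \<alpha>]])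
  also have "\<dots> = complex_of_real (sqrt (4 * pi * h) ^ DIM('a) * exp E *
      (sqrt (pi / \<alpha>) ^ DIM('a) * exp (- (norm (\<theta> - \<theta>'))\<^sup>2 / (4 * \<alpha>)) * sqrt (pi / \<alpha>) ^ DIM('a)))"
    unfolding fourier_gaussian(2)[OF \<alpha>] gaussian_shifted(2)[OF \<alpha>] by simp
  finally have lint: "(LINT Z|lborel. complex_of_real (exp (- s * (norm Z)\<^sup>2 / h)) * wigner h (wave_packet h \<theta>) (wave_packet h \<theta>') Z)
     = \<dots>" .
  \<comment> \<open>Per dimension, the integrals over z and \<zeta> give one factor
    \<open>sqrt (pi / \<alpha>)\<close> each; together they produce 1 / (1 + s), and the Weyl
    normalisation cancels 2 pi h.\<close>
  have "sqrt (4 * pi * h) * (sqrt (pi / \<alpha>) * sqrt (pi / \<alpha>)) = 2 * pi * h * (sqrt (pi * h) / (1 + s))"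
    using h s \<alpha> by (simp add: \<alpha>_def real_sqrt_mult)
  then have const: "sqrt (4 * pi * h) ^ DIM('a) * (sqrt (pi / \<alpha>) ^ DIM('a) * sqrt (pi / \<alpha>) ^ DIM('a)) / (2 * pi * h) ^ DIM('a)
     = sqrt (pi * h) ^ DIM('a) / (1 + s) ^ DIM('a)"
    using h by (simp only: power_mult_distrib[symmetric] power_divide[symmetric]) simp
  \<comment> \<open>The contributions of h / (1 + s) cancel in the coefficient of the squared norms
    and add up in that of the inner product, which is the origin of 2 / (1 + s) - 1.\<close>
  have expo: "E + - (norm (\<theta> - \<theta>'))\<^sup>2 / (4 * \<alpha>)
     = - h / 4 * ((norm \<theta>)\<^sup>2 + (norm \<theta>')\<^sup>2) + h / 2 * (2 / (1 + s) - 1) * (\<theta> \<bullet> \<theta>')"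
  proof -
    define a where "a = (norm \<theta>)\<^sup>2 + (norm \<theta>')\<^sup>2"
    define b where "b = \<theta> \<bullet> \<theta>'"
    define k where "k = h / (1 + s)"
    have N: "(norm (\<theta> - \<theta>'))\<^sup>2 = a - 2 * b" "(norm w)\<^sup>2 = (a + 2 * b) / 4"
      by (simp_all add: a_def b_def w_def power2_norm_eq_inner inner_simps inner_commute field_simps)
    have k: "x / \<alpha> = k * x" "x / (4 * \<alpha>) = k / 4 * x" "h / 2 * (2 / (1 + s) - 1) = k - h / 2" for x
      using h s by (simp_all add: k_def \<alpha>_def right_diff_distrib mult.commute)
    have "E + - (norm (\<theta> - \<theta>'))\<^sup>2 / (4 * \<alpha>) = - h / 4 * a + h / 2 * (2 / (1 + s) - 1) * b"
      unfolding E_def N k by (simp add: field_simps)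
    then show ?thesis by (simp only: a_def b_def)
  qed
  have "sqrt (4 * pi * h) ^ DIM('a) * exp E *
      (sqrt (pi / \<alpha>) ^ DIM('a) * exp (- (norm (\<theta> - \<theta>'))\<^sup>2 / (4 * \<alpha>)) * sqrt (pi / \<alpha>) ^ DIM('a)) / (2 * pi * h) ^ DIM('a)
     = (sqrt (4 * pi * h) ^ DIM('a) * (sqrt (pi / \<alpha>) ^ DIM('a) * sqrt (pi / \<alpha>) ^ DIM('a)) / (2 * pi * h) ^ DIM('a))
       * exp (E + - (norm (\<theta> - \<theta>'))\<^sup>2 / (4 * \<alpha>))"
    unfolding exp_add by (simp only: mult_ac times_divide_eq_right times_divide_eq_left)
  also have "\<dots> = sqrt (pi * h) ^ DIM('a) * exp (- h / 4 * ((norm \<theta>)\<^sup>2 + (norm \<theta>')\<^sup>2))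
      * (exp (h / 2 * (2 / (1 + s) - 1) * (\<theta> \<bullet> \<theta>')) / (1 + s) ^ DIM('a))"
    unfolding const expo exp_add by (simp only: mult_ac times_divide_eq_right times_divide_eq_left)
  finally show ?thesis
    unfolding lint of_real_divide[symmetric] by (simp only:)
qed

text \<open>The value of the Gaussian form at s = 0, that is v = 1. This agreement identifies the
  sum of the level weights with the squared norm.\<close>

lemma L2_inner_wave_packet:
  fixes \<theta> \<theta>' :: "'a::euclidean_space"
  assumes h: "h > 0"
  shows "L2_inner (wave_packet h \<theta>) (wave_packet h \<theta>') =
    complex_of_real (sqrt (pi * h) ^ DIM('a) * exp (- h / 4 * ((norm \<theta>)\<^sup>2 + (norm \<theta>')\<^sup>2)) * exp (h / 2 * (\<theta> \<bullet> \<theta>')))"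
proof -
  have "wave_packet h \<theta> x * cnj (wave_packet h \<theta>' x) =
     complex_of_real (exp (- (1 / h) * (norm x)\<^sup>2)) * cis ((\<theta> - \<theta>') \<bullet> x)" for x
  proof -
    have "wave_packet h \<theta> x * cnj (wave_packet h \<theta>' x) =
      complex_of_real (exp (- (norm x)\<^sup>2 / (2 * h)) * exp (- (norm x)\<^sup>2 / (2 * h))) * (cis (\<theta> \<bullet> x) * cis (- (\<theta>' \<bullet> x)))"
      by (simp add: wave_packet_def cis_cnj mult_ac)
    also have "exp (- (norm x)\<^sup>2 / (2 * h)) * exp (- (norm x)\<^sup>2 / (2 * h)) = exp (- (1 / h) * (norm x)\<^sup>2)"
      unfolding mult_exp_exp using h by (simp add: field_simps)
    finally show ?thesis by (simp add: cis_mult inner_diff_left)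
  qed
  then have "L2_inner (wave_packet h \<theta>) (wave_packet h \<theta>') =
     complex_of_real (sqrt (pi / (1 / h)) ^ DIM('a) * exp (- (norm (\<theta> - \<theta>'))\<^sup>2 / (4 * (1 / h))))"
    unfolding L2_inner_def using h by (subst fourier_gaussian(2)[symmetric]) simp_all
  also have "- (norm (\<theta> - \<theta>'))\<^sup>2 / (4 * (1 / h)) = - h / 4 * ((norm \<theta>)\<^sup>2 + (norm \<theta>')\<^sup>2) + h / 2 * (\<theta> \<bullet> \<theta>')"
  proof -
    have "(norm (\<theta> - \<theta>'))\<^sup>2 = (norm \<theta>)\<^sup>2 + (norm \<theta>')\<^sup>2 - 2 * (\<theta> \<bullet> \<theta>')"
      by (simp add: power2_norm_eq_inner inner_simps inner_commute)
    moreover have "- (norm (\<theta> - \<theta>'))\<^sup>2 / (4 * (1 / h)) = - h / 4 * (norm (\<theta> - \<theta>'))\<^sup>2"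
      by simp
    ultimately show ?thesis by (simp add: right_diff_distrib)
  qed
  finally show ?thesis by (simp only: exp_add mult.assoc) simp
qed

section \<open>Schwartz functions and \<open>L\<^sup>2\<close>\<close>

text \<open>A class of polynomials on the whole space, generated so that closure under directional
  derivatives and polynomial growth follow by induction. Every iterated derivative of a packet is
  such a function times the packet.\<close>

inductive poly_fun :: "('a::euclidean_space \<Rightarrow> complex) \<Rightarrow> bool" where
  const: "poly_fun (\<lambda>x. c)"
| inner: "poly_fun (\<lambda>x. complex_of_real (b \<bullet> x))"
| add: "poly_fun p \<Longrightarrow> poly_fun q \<Longrightarrow> poly_fun (\<lambda>x. p x + q x)"
| mult: "poly_fun p \<Longrightarrow> poly_fun q \<Longrightarrow> poly_fun (\<lambda>x. p x * q x)"

lemma poly_fun_has_derivative: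
  assumes "poly_fun p"
  shows "\<exists>D. (\<forall>x. (p has_derivative D x) (at x)) \<and> (\<forall>v. poly_fun (\<lambda>x. D x v))"
  using assms
proof induction
  case (const c)
  show ?case by (rule exI[of _ "\<lambda>x v. 0"]) (auto intro: poly_fun.intros)
next
  case (inner b)
  show ?case
    by (rule exI[of _ "\<lambda>x v. complex_of_real (b \<bullet> v)"])
       (auto intro!: poly_fun.intros derivative_eq_intros)
next
  case (add p q)
  then obtain D E where "\<forall>x. (p has_derivative D x) (at x)" "\<forall>v. poly_fun (\<lambda>x. D x v)"
    "\<forall>x. (q has_derivative E x) (at x)" "\<forall>v. poly_fun (\<lambda>x. E x v)" by blast
  then show ?case
    by (intro exI[of _ "\<lambda>x v. D x v + E x v"]) (auto intro!: poly_fun.intros has_derivative_add)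
next
  case (mult p q)
  then obtain D E where "\<forall>x. (p has_derivative D x) (at x)" "\<forall>v. poly_fun (\<lambda>x. D x v)"
    "\<forall>x. (q has_derivative E x) (at x)" "\<forall>v. poly_fun (\<lambda>x. E x v)" by blast
  then show ?case using mult.hyps
    by (intro exI[of _ "\<lambda>x v. p x * E x v + D x v * q x"]) (auto intro!: poly_fun.intros has_derivative_mult)
qed

lemma poly_fun_bound:
  assumes "poly_fun p"
  shows "\<exists>C m. \<forall>x. norm (p x) \<le> C * (1 + norm x) ^ m"
  using assms
proof induction
  case (const c)
  show ?case by (rule exI[of _ "norm c"], rule exI[of _ 0]) auto
next
  case (inner b)
  have "\<bar>b \<bullet> x\<bar> \<le> norm b * (1 + norm x) ^ 1" for x
    using Cauchy_Schwarz_ineq2[of b x] norm_ge_zero[of b] unfolding power_one_right distrib_left by linarith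
  then show ?case by (intro exI[of _ "norm b"] exI[of _ 1]) auto
next
  case (add p q)
  then obtain C m D n where *: "\<And>x. norm (p x) \<le> C * (1 + norm x) ^ m" "\<And>x. norm (q x) \<le> D * (1 + norm x) ^ n" by blast
  have "0 \<le> C" "0 \<le> D"
    using order_trans[OF norm_ge_zero *(1)[of 0]] order_trans[OF norm_ge_zero *(2)[of 0]] by auto
  then have "norm (p x + q x) \<le> (C + D) * (1 + norm x) ^ (m + n)" for x
  proof -
    have "C * (1 + norm x) ^ m \<le> C * (1 + norm x) ^ (m + n)" "D * (1 + norm x) ^ n \<le> D * (1 + norm x) ^ (m + n)"
      using \<open>0 \<le> C\<close> \<open>0 \<le> D\<close> by (auto intro!: mult_left_mono power_increasing)
    then show ?thesis using norm_triangle_ineq[of "p x" "q x"] *[of x] by (simp add: distrib_right)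
  qed
  then show ?case by blast
next
  case (mult p q)
  then obtain C m D n where *: "\<And>x. norm (p x) \<le> C * (1 + norm x) ^ m" "\<And>x. norm (q x) \<le> D * (1 + norm x) ^ n" by blast
  have "norm (p x * q x) \<le> (C * D) * (1 + norm x) ^ (m + n)" for x
  proof -
    have "norm (p x) * norm (q x) \<le> (C * (1 + norm x) ^ m) * (D * (1 + norm x) ^ n)"
      by (intro mult_mono * order_trans[OF norm_ge_zero *(1)] norm_ge_zero)
    then show ?thesis by (simp add: norm_mult power_add mult_ac)
  qed
  then show ?case by blast
qed

lemma wave_packet_has_derivative:
  assumes h: "h > 0"
  shows "(wave_packet h \<theta> has_derivative
    (\<lambda>v. (complex_of_real (- 1 / h) * complex_of_real (v \<bullet> x) + \<i> * complex_of_real (\<theta> \<bullet> v)) * wave_packet h \<theta> x)) (at x)"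
proof -
  have "wave_packet h \<theta> = (\<lambda>x. exp (complex_of_real (- (x \<bullet> x) / (2 * h)) + \<i> * complex_of_real (\<theta> \<bullet> x)))"
    by (simp only: fun_eq_iff wave_packet_def exp_add exp_of_real cis_conv_exp power2_norm_eq_inner) simp
  moreover have "((\<lambda>x. complex_of_real (- (x \<bullet> x) / (2 * h)) + \<i> * complex_of_real (\<theta> \<bullet> x)) has_derivative
     (\<lambda>v. complex_of_real (- 1 / h) * complex_of_real (v \<bullet> x) + \<i> * complex_of_real (\<theta> \<bullet> v))) (at x)"
    using h by (auto intro!: derivative_eq_intros simp: fun_eq_iff inner_commute field_simps)
  then have "((\<lambda>x. exp (complex_of_real (- (x \<bullet> x) / (2 * h)) + \<i> * complex_of_real (\<theta> \<bullet> x))) has_derivative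
     (\<lambda>v. (complex_of_real (- 1 / h) * complex_of_real (v \<bullet> x) + \<i> * complex_of_real (\<theta> \<bullet> v)) *
       exp (complex_of_real (- (x \<bullet> x) / (2 * h)) + \<i> * complex_of_real (\<theta> \<bullet> x)))) (at x)"
    by (rule has_derivative_compose[OF _ DERIV_exp[unfolded has_field_derivative_def], THEN has_derivative_eq_rhs])
       (simp add: mult.commute)
  ultimately show ?thesis by simp
qed

lemma partial_derivs_wave_packet:
  fixes \<theta> :: "'a::euclidean_space"
  assumes h: "h > 0"
  shows "\<exists>p. poly_fun p \<and> partial_derivs bs (wave_packet h \<theta>) = (\<lambda>x. p x * wave_packet h \<theta> x)"
proof (induction bs)
  case Nil
  show ?case by (rule exI[of _ "\<lambda>x. 1"]) (auto intro: poly_fun.intros)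
next
  case (Cons b bs)
  then obtain p where p: "poly_fun p" "partial_derivs bs (wave_packet h \<theta>) = (\<lambda>x. p x * wave_packet h \<theta> x)" by blast
  obtain D where D: "\<And>x. (p has_derivative D x) (at x)" "poly_fun (\<lambda>x. D x b)"
    using poly_fun_has_derivative[OF p(1)] by blast
  let ?q = "\<lambda>x. p x * (complex_of_real (- 1 / h) * complex_of_real (b \<bullet> x) + \<i> * complex_of_real (\<theta> \<bullet> b)) + D x b"
  have "partial_derivs (b # bs) (wave_packet h \<theta>) = (\<lambda>x. ?q x * wave_packet h \<theta> x)"
    unfolding partial_derivs.simps p(2)
    by (rule ext, subst frechet_derivative_at[OF has_derivative_mult[OF D(1) wave_packet_has_derivative[OF h]], symmetric])
       (simp add: algebra_simps)
  moreover have "poly_fun ?q"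
    by (intro poly_fun.intros p D)
  ultimately show ?case by blast
qed

text \<open>The Weyl formula is available only for Schwartz arguments. For the decay, powers of 1 +
  r are bounded by powers of exp r, and completing the square in (m + k) r - r^2 / (2 h) gives the
  constant (m + k)^2 h / 2.\<close>

lemma wave_packet_schwartz:
  assumes h: "h > 0"
  shows "wave_packet h \<theta> \<in> schwartz"
proof -
  have diff: "partial_derivs bs (wave_packet h \<theta>) differentiable (at x)" for bs x
  proof -
    obtain p where p: "poly_fun p" "partial_derivs bs (wave_packet h \<theta>) = (\<lambda>x. p x * wave_packet h \<theta> x)"
      using partial_derivs_wave_packet[OF h] by blast
    show ?thesis
      unfolding p(2) using poly_fun_has_derivative[OF p(1)] wave_packet_has_derivative[OF h]
      by (intro differentiable_mult) (auto simp: differentiable_def)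
  qed
  have "bounded (range (\<lambda>x. norm x ^ k *\<^sub>R partial_derivs bs (wave_packet h \<theta>) x))" for bs k
  proof -
    obtain p where p: "poly_fun p" "partial_derivs bs (wave_packet h \<theta>) = (\<lambda>x. p x * wave_packet h \<theta> x)"
      using partial_derivs_wave_packet[OF h] by blast
    obtain C m where C: "\<And>x. norm (p x) \<le> C * (1 + norm x) ^ m"
      using poly_fun_bound[OF p(1)] by blast
    have "0 \<le> C" using order_trans[OF norm_ge_zero C[of 0]] by simp
    have "norm (norm x ^ k *\<^sub>R partial_derivs bs (wave_packet h \<theta>) x) \<le> C * exp ((real (m + k))\<^sup>2 * h / 2)" for x
    proof -
      have "norm (norm x ^ k *\<^sub>R partial_derivs bs (wave_packet h \<theta>) x)
         = norm x ^ k * norm (p x) * exp (- (norm x)\<^sup>2 / (2 * h))"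
        by (simp add: p(2) norm_mult wave_packet_def)
      also have "\<dots> \<le> (1 + norm x) ^ k * (C * (1 + norm x) ^ m) * exp (- (norm x)\<^sup>2 / (2 * h))"
        by (intro mult_right_mono mult_mono power_mono C) auto
      also have "\<dots> = C * ((1 + norm x) ^ (m + k) * exp (- (norm x)\<^sup>2 / (2 * h)))"
        by (simp add: power_add mult_ac)
      also have "\<dots> \<le> C * (exp (norm x) ^ (m + k) * exp (- (norm x)\<^sup>2 / (2 * h)))"
        using \<open>0 \<le> C\<close> by (intro mult_left_mono mult_right_mono power_mono) auto
      also have "exp (norm x) ^ (m + k) * exp (- (norm x)\<^sup>2 / (2 * h)) = exp (real (m + k) * norm x - (norm x)\<^sup>2 / (2 * h))"
        by (simp add: exp_of_nat_mult[symmetric] mult_exp_exp)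
      also have "real (m + k) * norm x - (norm x)\<^sup>2 / (2 * h) \<le> (real (m + k))\<^sup>2 * h / 2"
      proof -
        have "0 \<le> (norm x - real (m + k) * h)\<^sup>2 / (2 * h)" using h by simp
        also have "\<dots> = (norm x)\<^sup>2 / (2 * h) - real (m + k) * norm x + (real (m + k))\<^sup>2 * h / 2"
          using h by (simp add: power2_diff power_mult_distrib add_divide_distrib diff_divide_distrib) (simp add: power2_eq_square)
        finally show ?thesis by simp
      qed
      finally show ?thesis using \<open>0 \<le> C\<close> by (simp add: mult_left_mono)
    qed
    then show ?thesis by (auto simp: bounded_iff)
  qed
  with diff show ?thesis by (auto simp: schwartz_def smooth_def)
qed

lemma schwartz_continuous:
  assumes "f \<in> schwartz"
  shows "continuous_on UNIV f"
proof -
  have "\<forall>x. f differentiable (at x)"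
    using assms unfolding schwartz_def smooth_def by (metis (mono_tags, lifting) empty_set empty_subsetI mem_Collect_eq partial_derivs.simps(1))
  then show ?thesis by (meson continuous_at_imp_continuous_on differentiable_imp_continuous_within)
qed

lemma schwartz_decay:
  assumes "f \<in> schwartz"
  obtains C where "\<And>x. norm x ^ k * norm (f x) \<le> C"
proof -
  have "bounded (range (\<lambda>x. norm x ^ k *\<^sub>R partial_derivs [] f x))"
    using assms by (simp add: schwartz_def del: partial_derivs.simps)
  then obtain C where "\<forall>x. norm (norm x ^ k *\<^sub>R f x) \<le> C" by (auto simp: bounded_iff)
  then show ?thesis by (intro that[of C]) auto
qed

lemma integrable_inverse_prod_Basis:
  "integrable lborel (\<lambda>x::'a::euclidean_space. \<Prod>b\<in>Basis. inverse (1 + (x \<bullet> b)\<^sup>2))"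
proof -
  have "integrable lborel (\<lambda>y::real. inverse (1 + y\<^sup>2))"
    using integrable_inverse_1_plus_square by (simp add: set_integrable_def)
  then have "integrable lborel (\<lambda>y::real. complex_of_real (inverse (1 + y\<^sup>2)))"
    by (rule integrable_of_real)
  then have "integrable lborel (\<lambda>x::'a. \<Prod>b\<in>Basis. complex_of_real (inverse (1 + (x \<bullet> b)\<^sup>2)))"
    by (intro lborel_integral_prod_Basis(1))
  then have "integrable lborel (\<lambda>x::'a. Re (\<Prod>b\<in>Basis. complex_of_real (inverse (1 + (x \<bullet> b)\<^sup>2))))"
    by (rule integrable_Re)
  then show ?thesis by (simp only: of_real_prod[symmetric] Re_complex_of_real)
qed

text \<open>The majorant is a product of 1 / (1 + x_b^2) over the coordinates. Its reciprocal is at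
  most (1 + |x|^2)^d, so bounds on f and on |x|^d f are enough after squaring.\<close>

lemma schwartz_L2_space:
  fixes f :: "'a::euclidean_space \<Rightarrow> complex"
  assumes f: "f \<in> schwartz"
  shows "f \<in> L2_space"
proof -
  let ?d = "DIM('a)"
  obtain C0 where C0: "\<And>x. norm x ^ 0 * norm (f x) \<le> C0" using schwartz_decay[OF f, of 0] by blast
  obtain C1 where C1: "\<And>x. norm x ^ ?d * norm (f x) \<le> C1" using schwartz_decay[OF f, of ?d] by blast
  have nonneg: "0 \<le> C0" "0 \<le> C1" using C0[of 0] C1[of 0] norm_ge_zero[of "f 0"] by (auto intro: order_trans[rotated])
  have bound: "(norm (f x))\<^sup>2 \<le> 2 ^ ?d * (C0\<^sup>2 + C1\<^sup>2) * (\<Prod>b\<in>Basis. inverse (1 + (x \<bullet> b)\<^sup>2))" for x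
  proof -
    have "(norm (f x))\<^sup>2 * (\<Prod>b\<in>Basis. 1 + (x \<bullet> b)\<^sup>2) \<le> (norm (f x))\<^sup>2 * (\<Prod>b\<in>(Basis::'a set). 1 + (norm x)\<^sup>2)"
      by (intro mult_left_mono prod_mono) (auto simp: Basis_le_norm abs_le_square_iff[symmetric] add_nonneg_nonneg)
    also have "\<dots> = (norm (f x))\<^sup>2 * (1 + (norm x)\<^sup>2) ^ ?d" by simp
    also have "\<dots> \<le> (norm (f x))\<^sup>2 * (2 ^ ?d * (1 + norm x ^ (2 * ?d)))"
    proof (intro mult_left_mono)
      show "(1 + (norm x)\<^sup>2) ^ ?d \<le> 2 ^ ?d * (1 + norm x ^ (2 * ?d))"
      proof (cases "norm x \<le> 1")
        case True
        then have "(norm x)\<^sup>2 \<le> 1" by (simp add: power_le_one)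
        then have "(1 + (norm x)\<^sup>2) ^ ?d \<le> 2 ^ ?d" by (intro power_mono) auto
        then show ?thesis by (rule order_trans) auto
      next
        case False
        then have "(1 + (norm x)\<^sup>2) ^ ?d \<le> (2 * (norm x)\<^sup>2) ^ ?d" by (intro power_mono) auto
        also have "\<dots> = 2 ^ ?d * norm x ^ (2 * ?d)" by (simp add: power_mult_distrib power_mult)
        finally show ?thesis by (rule order_trans) auto
      qed
    qed auto
    also have "\<dots> = 2 ^ ?d * ((norm (f x))\<^sup>2 + (norm x ^ ?d * norm (f x))\<^sup>2)"
      by (simp add: algebra_simps power_mult_distrib power_mult[symmetric] mult.commute)
    also have "\<dots> \<le> 2 ^ ?d * (C0\<^sup>2 + C1\<^sup>2)"
      using C0[of x] C1[of x] by (intro mult_left_mono add_mono power_mono) auto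
    finally have le: "(norm (f x))\<^sup>2 * (\<Prod>b\<in>Basis. 1 + (x \<bullet> b)\<^sup>2) \<le> 2 ^ ?d * (C0\<^sup>2 + C1\<^sup>2)" .
    have "0 < (\<Prod>b\<in>Basis. 1 + (x \<bullet> b)\<^sup>2)" by (intro prod_pos) (auto simp: add_pos_nonneg)
    then have "(norm (f x))\<^sup>2 \<le> 2 ^ ?d * (C0\<^sup>2 + C1\<^sup>2) / (\<Prod>b\<in>Basis. 1 + (x \<bullet> b)\<^sup>2)"
      using le by (simp only: pos_le_divide_eq)
    then show ?thesis
      unfolding divide_inverse prod_inversef[symmetric] comp_def .
  qed
  have meas: "f \<in> borel_measurable borel"
    using schwartz_continuous[OF f] by (rule borel_measurable_continuous_onI)
  have "integrable lborel (\<lambda>x. (norm (f x))\<^sup>2)"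
    by (rule Bochner_Integration.integrable_bound[OF integrable_mult_right[OF integrable_inverse_prod_Basis, of "2 ^ ?d * (C0\<^sup>2 + C1\<^sup>2)"]])
       (use meas bound in \<open>auto intro!: order_trans[OF bound] simp: abs_mult prod_nonneg\<close>)
  then show ?thesis using meas by (simp add: L2_space_def)
qed

section \<open>Inner product and norm on square-integrable functions\<close>

lemma L2_space_integrable_mult:
  assumes "f \<in> L2_space" "g \<in> L2_space"
  shows "integrable lborel (\<lambda>x. f x * cnj (g x))"
proof (rule Bochner_Integration.integrable_bound)
  show "integrable lborel (\<lambda>x. (norm (f x))\<^sup>2 + (norm (g x))\<^sup>2)"
    using assms by (auto simp: L2_space_def)
  have [measurable]: "f \<in> borel_measurable borel" "g \<in> borel_measurable borel"
    using assms by (auto simp: L2_space_def)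
  have "(\<lambda>x. cnj (g x)) \<in> borel_measurable borel"
    by (rule measurable_compose[OF _ borel_measurable_continuous_onI]) (auto intro: continuous_intros)
  then show "(\<lambda>x. f x * cnj (g x)) \<in> borel_measurable lborel" by simp
  have "norm a * norm b \<le> (norm a)\<^sup>2 + (norm b)\<^sup>2" for a b :: complex
    using sum_squares_bound[of "norm a" "norm b"] mult_nonneg_nonneg[OF norm_ge_zero[of a] norm_ge_zero[of b]]
    by linarith
  then show "AE x in lborel. norm (f x * cnj (g x)) \<le> norm ((norm (f x))\<^sup>2 + (norm (g x))\<^sup>2)"
    by (simp add: norm_mult)
qed

lemma L2_space_add:
  assumes "f \<in> L2_space" "g \<in> L2_space"
  shows "(\<lambda>x. f x + g x) \<in> L2_space"
proof -
  have [measurable]: "f \<in> borel_measurable borel" "g \<in> borel_measurable borel"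
    using assms by (auto simp: L2_space_def)
  have "integrable lborel (\<lambda>x. (norm (f x + g x))\<^sup>2)"
  proof (rule Bochner_Integration.integrable_bound)
    show "integrable lborel (\<lambda>x. 2 * (norm (f x))\<^sup>2 + 2 * (norm (g x))\<^sup>2)"
      using assms by (auto simp: L2_space_def)
    have "(norm (a + b))\<^sup>2 \<le> 2 * (norm a)\<^sup>2 + 2 * (norm b)\<^sup>2" for a b :: complex
    proof -
      have "(norm (a + b))\<^sup>2 \<le> (norm a + norm b)\<^sup>2" by (intro power_mono norm_triangle_ineq) auto
      also have "\<dots> \<le> 2 * (norm a)\<^sup>2 + 2 * (norm b)\<^sup>2"
        using sum_squares_bound[of "norm a" "norm b"] by (simp add: power2_sum)
      finally show ?thesis .
    qed
    then show "AE x in lborel. norm ((norm (f x + g x))\<^sup>2) \<le> norm (2 * (norm (f x))\<^sup>2 + 2 * (norm (g x))\<^sup>2)"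
      by simp
  qed measurable
  then show ?thesis by (simp add: L2_space_def)
qed

lemma L2_space_cmult: "f \<in> L2_space \<Longrightarrow> (\<lambda>x. c * f x) \<in> L2_space"
  by (auto simp: L2_space_def norm_mult power_mult_distrib)

lemma L2_inner_self: "L2_inner f f = complex_of_real ((L2_norm f)\<^sup>2)"
proof -
  have "L2_inner f f = (LINT x|lborel. complex_of_real ((norm (f x))\<^sup>2))"
    unfolding L2_inner_def complex_norm_square ..
  also have "\<dots> = complex_of_real (LINT x|lborel. (norm (f x))\<^sup>2)" by (rule integral_complex_of_real)
  finally show ?thesis by (simp add: L2_norm_def)
qed

lemma L2_inner_norm_le:
  assumes f: "f \<in> L2_space" and g: "g \<in> L2_space"
  shows "norm (L2_inner f g) \<le> L2_norm f * L2_norm g"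
proof -
  have [measurable]: "f \<in> borel_measurable borel" "g \<in> borel_measurable borel"
    using assms by (auto simp: L2_space_def)
  have sq: "(\<integral>\<^sup>+x. (ennreal (norm (u x)))\<^sup>2 \<partial>lborel) = ennreal ((L2_norm u)\<^sup>2)" if "u \<in> L2_space" for u :: "'a \<Rightarrow> complex"
    using that nn_integral_eq_integral[of lborel "\<lambda>x. (norm (u x))\<^sup>2"]
    by (simp add: L2_space_def L2_norm_def ennreal_power)
  have int: "integrable lborel (\<lambda>x. norm (f x) * norm (g x))"
    using integrable_norm[OF L2_space_integrable_mult[OF f g]] by (simp add: norm_mult)
  define I where "I = (LINT x|lborel. norm (f x) * norm (g x))"
  have I0: "0 \<le> I" unfolding I_def by simp
  have "(\<integral>\<^sup>+x. ennreal (norm (f x)) * ennreal (norm (g x)) \<partial>lborel) = ennreal I"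
    unfolding I_def using nn_integral_eq_integral[OF int] by (simp add: ennreal_mult)
  then have "(ennreal I)\<^sup>2 \<le> ennreal ((L2_norm f)\<^sup>2) * ennreal ((L2_norm g)\<^sup>2)"
    using Cauchy_Schwarz_nn_integral[of "\<lambda>x. ennreal (norm (f x))" lborel "\<lambda>x. ennreal (norm (g x))"]
    by (simp add: sq f g)
  then have "I\<^sup>2 \<le> (L2_norm f * L2_norm g)\<^sup>2"
    using I0 by (simp add: ennreal_power ennreal_mult[symmetric] power_mult_distrib)
  then have "I \<le> L2_norm f * L2_norm g"
    by (rule power2_le_imp_le) (simp add: L2_norm_def)
  moreover have "norm (L2_inner f g) \<le> I"
    unfolding L2_inner_def I_def using integral_norm_bound[of lborel "\<lambda>x. f x * cnj (g x)"] by (simp add: norm_mult)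
  ultimately show ?thesis by simp
qed

lemma L2_norm_nonneg: "0 \<le> L2_norm f"
  by (simp add: L2_norm_def)

lemma L2_inner_add_left:
  assumes "f \<in> L2_space" "g \<in> L2_space" "k \<in> L2_space"
  shows "L2_inner (\<lambda>x. f x + g x) k = L2_inner f k + L2_inner g k"
  unfolding L2_inner_def distrib_right
  by (intro Bochner_Integration.integral_add L2_space_integrable_mult assms)

lemma L2_inner_add_right:
  assumes "f \<in> L2_space" "g \<in> L2_space" "k \<in> L2_space"
  shows "L2_inner k (\<lambda>x. f x + g x) = L2_inner k f + L2_inner k g"
  unfolding L2_inner_def complex_cnj_add distrib_left
  by (intro Bochner_Integration.integral_add L2_space_integrable_mult assms)

lemma L2_inner_cmult_left: "L2_inner (\<lambda>x. c * f x) g = c * L2_inner f g"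
  by (simp add: L2_inner_def mult.assoc)

lemma L2_inner_cmult_right: "L2_inner f (\<lambda>x. c * g x) = cnj c * L2_inner f g"
  by (simp add: L2_inner_def mult.left_commute)

text \<open>Operators are additive and homogeneous only up to null sets; this transfers their
  linearity to inner products.\<close>

lemma L2_inner_AE_cong_left:
  assumes "AE x in lborel. f x = g x" "f \<in> L2_space" "g \<in> L2_space" "k \<in> L2_space"
  shows "L2_inner f k = L2_inner g k"
  unfolding L2_inner_def
proof (rule integral_cong_AE)
  show "AE x in lborel. f x * cnj (k x) = g x * cnj (k x)" using assms(1) by eventually_elim simp
qed (use L2_space_integrable_mult assms in \<open>blast intro: borel_measurable_integrable\<close>)+

lemma L2_norm_triangle:
  assumes f: "f \<in> L2_space" and g: "g \<in> L2_space"
  shows "L2_norm (\<lambda>x. f x + g x) \<le> L2_norm f + L2_norm g"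
proof (rule power2_le_imp_le)
  have "complex_of_real ((L2_norm (\<lambda>x. f x + g x))\<^sup>2)
      = L2_inner f f + L2_inner f g + (L2_inner g f + L2_inner g g)"
    unfolding L2_inner_self[symmetric]
    by (simp add: L2_inner_add_left L2_inner_add_right f g L2_space_add)
  then have "(L2_norm (\<lambda>x. f x + g x))\<^sup>2 = Re (L2_inner f f + L2_inner f g + (L2_inner g f + L2_inner g g))"
    by (metis Re_complex_of_real)
  also have "\<dots> \<le> (L2_norm f)\<^sup>2 + L2_norm f * L2_norm g + (L2_norm g * L2_norm f + (L2_norm g)\<^sup>2)"
    using complex_Re_le_cmod[of "L2_inner f g"] L2_inner_norm_le[OF f g]
      complex_Re_le_cmod[of "L2_inner g f"] L2_inner_norm_le[OF g f]
    unfolding L2_inner_self plus_complex.sel Re_complex_of_real by linarith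
  also have "\<dots> = (L2_norm f + L2_norm g)\<^sup>2" by (simp add: power2_sum)
  finally show "(L2_norm (\<lambda>x. f x + g x))\<^sup>2 \<le> (L2_norm f + L2_norm g)\<^sup>2" .
qed (simp add: L2_norm_nonneg)

section \<open>Density of wave packets\<close>

text \<open>Trigonometric polynomials with arbitrary real frequencies: times the fixed Gaussian they
  are exactly the finite combinations of wave packets.\<close>

inductive trig_fun :: "('a::euclidean_space \<Rightarrow> complex) \<Rightarrow> bool" where
  cis: "trig_fun (\<lambda>x. c * cis (\<theta> \<bullet> x))"
| add: "trig_fun p \<Longrightarrow> trig_fun q \<Longrightarrow> trig_fun (\<lambda>x. p x + q x)"

lemma trig_fun_const: "trig_fun (\<lambda>x. c)"
  using trig_fun.cis[of c 0] by simp

lemma trig_fun_mult: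
  assumes "trig_fun p" "trig_fun q"
  shows "trig_fun (\<lambda>x. p x * q x)"
  using assms
proof (induction p)
  case (cis c \<theta>)
  from cis.prems show ?case
  proof (induction q)
    case (cis d \<eta>)
    have "(\<lambda>x. c * cis (\<theta> \<bullet> x) * (d * cis (\<eta> \<bullet> x))) = (\<lambda>x. c * d * cis ((\<theta> + \<eta>) \<bullet> x))"
      by (simp add: inner_add_left cis_mult[symmetric] mult_ac)
    then show ?case using trig_fun.cis by metis
  next
    case (add p q)
    then show ?case using trig_fun.add by (auto simp: distrib_left)
  qed
next
  case (add p1 p2)
  then show ?case using trig_fun.add[of "\<lambda>x. p1 x * q x" "\<lambda>x. p2 x * q x"] by (simp add: distrib_right)
qed

lemma trig_fun_sum:
  assumes "\<And>i. i \<in> I \<Longrightarrow> trig_fun (p i)"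
  shows "trig_fun (\<lambda>x. \<Sum>i\<in>I. p i x)"
  using assms
  by (induction I rule: infinite_finite_induct) (auto intro: trig_fun_const trig_fun.add)

lemma trig_fun_cos: "trig_fun (\<lambda>x. complex_of_real (cos (\<theta> \<bullet> x)))"
proof -
  have "(\<lambda>x. complex_of_real (cos (\<theta> \<bullet> x))) = (\<lambda>x. (1/2) * cis (\<theta> \<bullet> x) + (1/2) * cis ((- \<theta>) \<bullet> x))"
    by (auto simp: complex_eq_iff)
  then show ?thesis using trig_fun.intros by metis
qed

lemma trig_fun_sin: "trig_fun (\<lambda>x. complex_of_real (sin (\<theta> \<bullet> x)))"
proof -
  have "(\<lambda>x. complex_of_real (sin (\<theta> \<bullet> x))) = (\<lambda>x. (-\<i>/2) * cis (\<theta> \<bullet> x) + (\<i>/2) * cis ((- \<theta>) \<bullet> x))"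
    by (auto simp: complex_eq_iff)
  then show ?thesis using trig_fun.intros by metis
qed

lemma trig_fun_representation:
  assumes "trig_fun p"
  shows "\<exists>(n::nat) c \<theta>. p = (\<lambda>x. \<Sum>i<n. c i * cis (\<theta> i \<bullet> x))"
  using assms
proof induction
  case (cis c \<theta>)
  show ?case by (rule exI[of _ 1], rule exI[of _ "\<lambda>_. c"], rule exI[of _ "\<lambda>_. \<theta>"]) simp
next
  case (add p q)
  from add.IH(1) obtain n c \<theta> where p: "p = (\<lambda>x. \<Sum>i<(n::nat). c i * cis (\<theta> i \<bullet> x))" by blast
  from add.IH(2) obtain m d \<eta> where q: "q = (\<lambda>x. \<Sum>i<(m::nat). d i * cis (\<eta> i \<bullet> x))" by blast
  have "(\<Sum>i<n + m. F i) = (\<Sum>i<n. F i) + (\<Sum>i<m. F (n + i))" for F :: "nat \<Rightarrow> complex"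
    by (induction m) (simp_all add: add.assoc)
  then show ?case unfolding p q
    by (intro exI[of _ "n + m"] exI[of _ "\<lambda>i. if i < n then c i else d (i - n)"]
        exI[of _ "\<lambda>i. if i < n then \<theta> i else \<eta> (i - n)"]) simp
qed

text \<open>Each coordinate is wrapped around a circle with period 2 pi L, recorded by its cosine
  and sine. Real polynomials pulled back along this map are trigonometric polynomials, so
  Stone-Weierstrass on a compact box applies.\<close>

definition torus_map :: "real \<Rightarrow> 'a::euclidean_space \<Rightarrow> 'a \<times> 'a" where
  "torus_map L x = (\<Sum>b\<in>Basis. cos ((b /\<^sub>R L) \<bullet> x) *\<^sub>R b, \<Sum>b\<in>Basis. sin ((b /\<^sub>R L) \<bullet> x) *\<^sub>R b)"

lemma trig_fun_polynomial_torus_map: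
  fixes P :: "'a::euclidean_space \<times> 'a \<Rightarrow> real"
  assumes "real_polynomial_function P"
  shows "trig_fun (\<lambda>x. complex_of_real (P (torus_map L x)))"
  using assms
proof induction
  case (linear f)
  interpret bounded_linear f by fact
  have expand: "f (torus_map L x) = (\<Sum>b\<in>Basis. cos ((b /\<^sub>R L) \<bullet> x) * f (b, 0)) + (\<Sum>b\<in>Basis. sin ((b /\<^sub>R L) \<bullet> x) * f (0, b))" for x
  proof -
    have "torus_map L x = (\<Sum>b\<in>Basis. cos ((b /\<^sub>R L) \<bullet> x) *\<^sub>R (b, 0)) + (\<Sum>b\<in>Basis. sin ((b /\<^sub>R L) \<bullet> x) *\<^sub>R (0, b))"
      by (simp add: torus_map_def prod_eq_iff fst_sum snd_sum)
    then show ?thesis by (simp only: add sum scaleR real_scaleR_def)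
  qed
  show ?case
    unfolding expand of_real_add of_real_sum of_real_mult
    by (intro trig_fun.add trig_fun_sum trig_fun_mult trig_fun_cos trig_fun_sin trig_fun_const)
next
  case (const c)
  show ?case by (rule trig_fun_const)
next
  case (add f g)
  then show ?case by (simp add: trig_fun.add)
next
  case (mult f g)
  then show ?case by (simp add: trig_fun_mult)
qed

text \<open>A compactly supported function is extended periodically in each coordinate. On the torus, in the
  coordinates \<open>(c, s) = (cos, sin)\<close>, the extension is \<open>g (L arcsin s)\<close> times a cutoff that equals \<open>1\<close>
  for \<open>c \<ge> 1/2\<close> and vanishes for \<open>c \<le> 0\<close>.\<close>

lemma trig_fun_approx_real:
  fixes g :: "'a::euclidean_space \<Rightarrow> real"
  assumes g: "continuous_on UNIV g" and supp: "\<And>x. norm x > R \<Longrightarrow> g x = 0"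
    and B: "\<And>x. \<bar>g x\<bar> \<le> B" and L: "L > 0" "L \<ge> R" and \<delta>: "\<delta> > 0"
  obtains q where "trig_fun (\<lambda>x. complex_of_real (q x))" "\<And>x. \<bar>q x\<bar> \<le> B + \<delta>"
    "\<And>x. norm x \<le> L \<Longrightarrow> \<bar>g x - q x\<bar> < \<delta>"
proof -
  define K :: "('a \<times> 'a) set" where "K = cbox (- One) One \<times> cbox (- One) One"
  define cut where "cut t = max 0 (min 1 (2 * t))" for t :: real
  define G :: "'a \<times> 'a \<Rightarrow> real" where "G = (\<lambda>(c, s). g (\<Sum>b\<in>Basis. (L * arcsin (s \<bullet> b)) *\<^sub>R b) * (\<Prod>b\<in>Basis. cut (c \<bullet> b)))"
  have "compact K" unfolding K_def by (intro compact_Times compact_cbox)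
  have range: "-1 \<le> snd p \<bullet> b \<and> snd p \<bullet> b \<le> 1" if "p \<in> K" "b \<in> Basis" for p b
    using that by (auto simp: K_def mem_box)
  have "continuous_on K G"
    unfolding G_def case_prod_beta cut_def
    by (intro continuous_intros continuous_on_compose2[OF g] continuous_on_compose2[OF continuous_on_arcsin'])
       (use range in auto)
  then obtain P where P: "real_polynomial_function P" "\<And>p. p \<in> K \<Longrightarrow> \<bar>G p - P p\<bar> < \<delta>"
    using Stone_Weierstrass_real_polynomial_function[OF \<open>compact K\<close> _ \<delta>] by blast
  have inK: "torus_map L x \<in> K" for x
    by (auto simp: torus_map_def K_def mem_box inner_sum_left_Basis)
  have cutoff: "0 \<le> cut t" "cut t \<le> 1" for t by (auto simp: cut_def)
  \<comment> \<open>The bound holds for all p, hence the approximant is controlled on the whole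
    space, also where it is not close to \<open>g\<close>.\<close>
  have GB: "\<bar>G p\<bar> \<le> B" for p
  proof -
    obtain c s where p: "p = (c, s)" by (cases p)
    have "\<bar>\<Prod>b\<in>Basis. cut (c \<bullet> b)\<bar> \<le> 1"
      using cutoff by (simp add: abs_prod prod_le_1 prod_nonneg)
    then have "\<bar>G p\<bar> \<le> \<bar>g (\<Sum>b\<in>Basis. (L * arcsin (s \<bullet> b)) *\<^sub>R b)\<bar> * 1"
      unfolding G_def p case_prod_conv abs_mult by (intro mult_left_mono) auto
    then show ?thesis using B by (metis mult.right_neutral order_trans)
  qed
  have Gg: "G (torus_map L x) = g x" if x: "norm x \<le> L" for x
  proof -
    have comp: "\<bar>(b /\<^sub>R L) \<bullet> x\<bar> \<le> 1" if "b \<in> Basis" for b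
      using Basis_le_norm[OF that, of x] x L by (simp add: inner_commute abs_mult field_simps)
    have "(\<Sum>b\<in>Basis. (L * arcsin (snd (torus_map L x) \<bullet> b)) *\<^sub>R b) = (\<Sum>b\<in>Basis. (x \<bullet> b) *\<^sub>R b)"
    proof (rule sum.cong[OF refl])
      fix b :: 'a assume b: "b \<in> Basis"
      have "arcsin (sin ((b /\<^sub>R L) \<bullet> x)) = (b /\<^sub>R L) \<bullet> x"
        using comp[OF b] pi_gt3 by (intro arcsin_sin) auto
      moreover have "snd (torus_map L x) \<bullet> b = sin ((b /\<^sub>R L) \<bullet> x)"
        using b by (simp add: torus_map_def inner_sum_left_Basis)
      ultimately have "arcsin (snd (torus_map L x) \<bullet> b) = (b /\<^sub>R L) \<bullet> x" by (simp only:)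
      then show "(L * arcsin (snd (torus_map L x) \<bullet> b)) *\<^sub>R b = (x \<bullet> b) *\<^sub>R b"
        using L by (simp add: inner_commute)
    qed
    moreover have "cut (fst (torus_map L x) \<bullet> b) = 1" if b: "b \<in> Basis" for b
    proof -
      \<comment> \<open>Inside the ball each rescaled coordinate is at most 1 < pi / 3 in absolute
        value, so the cosine reaches the threshold 1 / 2 above which the cutoff is 1.\<close>
      have "cos (pi / 3) \<le> cos \<bar>(b /\<^sub>R L) \<bullet> x\<bar>"
        using comp[OF b] pi_gt3 by (intro cos_monotone_0_pi_le) auto
      then have "1 / 2 \<le> cos ((b /\<^sub>R L) \<bullet> x)" by (simp add: cos_60)
      then show ?thesis using b by (simp add: torus_map_def inner_sum_left_Basis cut_def)
    qed
    ultimately show ?thesis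
      by (simp add: G_def case_prod_beta euclidean_representation)
  qed
  show ?thesis
  proof (rule that[of "\<lambda>x. P (torus_map L x)"])
    show "trig_fun (\<lambda>x. complex_of_real (P (torus_map L x)))"
      by (rule trig_fun_polynomial_torus_map[OF P(1)])
    show "\<bar>P (torus_map L x)\<bar> \<le> B + \<delta>" for x
      using P(2)[OF inK, of x] GB[of "torus_map L x"] by linarith
    show "\<bar>g x - P (torus_map L x)\<bar> < \<delta>" if "norm x \<le> L" for x
      using P(2)[OF inK, of x] Gg[OF that] by simp
  qed
qed

text \<open>The n-th approximant has error below 1 / (n + 1) on a ball of radius growing with n, and
  outside only the common bound survives. Pointwise convergence with a common bound is what
  dominated convergence under a Gaussian weight requires. Real and imaginary parts are treated
  separately.\<close>

lemma trig_fun_approx: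
  fixes g :: "'a::euclidean_space \<Rightarrow> complex"
  assumes g: "continuous_on UNIV g" and supp: "\<And>x. norm x > R \<Longrightarrow> g x = 0"
  obtains q B where "\<And>n::nat. trig_fun (q n)" "\<And>n x. norm (q n x) \<le> B" "\<And>x. (\<lambda>n. q n x) \<longlonglongrightarrow> g x"
proof -
  have "bounded (g ` cball 0 R)"
    by (intro compact_imp_bounded compact_continuous_image continuous_on_subset[OF g]) auto
  then obtain B0 where B0: "\<And>x. x \<in> cball 0 R \<Longrightarrow> norm (g x) \<le> B0"
    unfolding bounded_iff by blast
  define B where "B = max 0 B0"
  have B: "norm (g x) \<le> B" for x
    using B0[of x] supp[of x] by (cases "norm x \<le> R") (auto simp: B_def)
  have ex: "\<exists>q. trig_fun (\<lambda>x. complex_of_real (q x)) \<and> (\<forall>x. \<bar>q x\<bar> \<le> B + 1 / real (Suc n)) \<and>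
     (\<forall>x. norm x \<le> \<bar>R\<bar> + real (Suc n) \<longrightarrow> \<bar>u x - q x\<bar> < 1 / real (Suc n))"
    if "continuous_on UNIV u" "\<And>x. norm x > R \<Longrightarrow> u x = 0" "\<And>x. \<bar>u x\<bar> \<le> B" for u :: "'a \<Rightarrow> real" and n
  proof (rule trig_fun_approx_real[OF that, where L = "\<bar>R\<bar> + real (Suc n)" and \<delta> = "1 / real (Suc n)"])
    show "0 < \<bar>R\<bar> + real (Suc n)" "R \<le> \<bar>R\<bar> + real (Suc n)" "0 < 1 / real (Suc n)"
      by auto
  qed blast+
  have seq: "\<exists>q. \<forall>n. trig_fun (\<lambda>x. complex_of_real (q n x)) \<and> (\<forall>x. \<bar>q n x\<bar> \<le> B + 1 / real (Suc n)) \<and>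
     (\<forall>x. norm x \<le> \<bar>R\<bar> + real (Suc n) \<longrightarrow> \<bar>u x - q n x\<bar> < 1 / real (Suc n))"
    if "continuous_on UNIV u" "\<And>x. norm x > R \<Longrightarrow> u x = 0" "\<And>x. \<bar>u x\<bar> \<le> B" for u :: "'a \<Rightarrow> real"
    using ex[OF that] by (intro choice allI) blast
  have *: "\<exists>q. (\<forall>n::nat. trig_fun (\<lambda>x. complex_of_real (q n x))) \<and> (\<forall>n x. \<bar>q n x\<bar> \<le> B + 1) \<and> (\<forall>x. (\<lambda>n. q n x) \<longlonglongrightarrow> u x)"
    if u: "continuous_on UNIV u" "\<And>x. norm x > R \<Longrightarrow> u x = 0" "\<And>x. \<bar>u x\<bar> \<le> B" for u :: "'a \<Rightarrow> real"
  proof -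
    obtain q where q: "\<And>n. trig_fun (\<lambda>x. complex_of_real (q n x))" "\<And>n x. \<bar>q n x\<bar> \<le> B + 1 / real (Suc n)"
      "\<And>n x. norm x \<le> \<bar>R\<bar> + real (Suc n) \<Longrightarrow> \<bar>u x - q n x\<bar> < 1 / real (Suc n)"
      using seq[OF u] by blast
    have "\<bar>q n x\<bar> \<le> B + 1" for n x
      using q(2)[of n x] by (rule order_trans) simp
    moreover have "(\<lambda>n. q n x) \<longlonglongrightarrow> u x" for x
    proof -
      have "(\<lambda>n. u x - q n x) \<longlonglongrightarrow> 0"
      proof (rule Lim_null_comparison)
        have "\<forall>\<^sub>F n in sequentially. norm x \<le> real n"
          by (rule eventually_sequentiallyI[of "nat \<lceil>norm x\<rceil>"]) linarith
        then show "\<forall>\<^sub>F n in sequentially. norm (u x - q n x) \<le> 1 / real (Suc n)"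
        proof eventually_elim
          case (elim n)
          then have "norm x \<le> \<bar>R\<bar> + real (Suc n)" by simp
          from q(3)[OF this] show ?case by simp
        qed
        show "(\<lambda>n. 1 / real (Suc n)) \<longlonglongrightarrow> 0" using LIMSEQ_Suc[OF lim_1_over_n] by simp
      qed
      then have "(\<lambda>n. u x - (u x - q n x)) \<longlonglongrightarrow> u x - 0" by (intro tendsto_intros)
      then show ?thesis by simp
    qed
    ultimately show ?thesis using q(1) by blast
  qed
  have "continuous_on UNIV (\<lambda>x. Re (g x))" "continuous_on UNIV (\<lambda>x. Im (g x))"
    by (intro continuous_intros g)+
  moreover have "\<bar>Re (g x)\<bar> \<le> B" "\<bar>Im (g x)\<bar> \<le> B" for x
    using B[of x] abs_Re_le_cmod[of "g x"] abs_Im_le_cmod[of "g x"] by linarith+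
  ultimately obtain q r where
    q: "\<And>n::nat. trig_fun (\<lambda>x. complex_of_real (q n x))" "\<And>n x. \<bar>q n x\<bar> \<le> B + 1" "\<And>x. (\<lambda>n. q n x) \<longlonglongrightarrow> Re (g x)" and
    r: "\<And>n::nat. trig_fun (\<lambda>x. complex_of_real (r n x))" "\<And>n x. \<bar>r n x\<bar> \<le> B + 1" "\<And>x. (\<lambda>n. r n x) \<longlonglongrightarrow> Im (g x)"
    using *[of "\<lambda>x. Re (g x)"] *[of "\<lambda>x. Im (g x)"] supp by auto
  show ?thesis
  proof (rule that[of "\<lambda>n x. complex_of_real (q n x) + \<i> * complex_of_real (r n x)" "2 * (B + 1)"])
    show "trig_fun (\<lambda>x. complex_of_real (q n x) + \<i> * complex_of_real (r n x))" for n
      by (intro trig_fun.add trig_fun_mult trig_fun_const q r)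
    show "norm (complex_of_real (q n x) + \<i> * complex_of_real (r n x)) \<le> 2 * (B + 1)" for n x
      using norm_triangle_ineq[of "complex_of_real (q n x)" "\<i> * complex_of_real (r n x)"] q(2)[of n x] r(2)[of n x]
      by (simp add: norm_mult)
    have "(\<lambda>n. complex_of_real (q n x) + \<i> * complex_of_real (r n x)) \<longlonglongrightarrow> complex_of_real (Re (g x)) + \<i> * complex_of_real (Im (g x))" for x
      by (intro tendsto_intros q r)
    then show "(\<lambda>n. complex_of_real (q n x) + \<i> * complex_of_real (r n x)) \<longlonglongrightarrow> g x" for x
      by (simp add: complex_eq[symmetric])
  qed
qed

lemma trig_fun_continuous: "trig_fun p \<Longrightarrow> continuous_on UNIV p"
  by (induction rule: trig_fun.induct) (auto intro!: continuous_intros)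

lemma L2_norm_tendsto_0:
  fixes u :: "nat \<Rightarrow> 'a::euclidean_space \<Rightarrow> complex"
  assumes [measurable]: "\<And>n. u n \<in> borel_measurable borel"
    and w: "integrable lborel w" and bound: "\<And>n x. (norm (u n x))\<^sup>2 \<le> w x"
    and lim: "\<And>x. (\<lambda>n. u n x) \<longlonglongrightarrow> 0"
  shows "(\<lambda>n. L2_norm (u n)) \<longlonglongrightarrow> 0"
proof -
  have "(\<lambda>n. LINT x|lborel. (norm (u n x))\<^sup>2) \<longlonglongrightarrow> (LINT x|(lborel :: 'a measure). 0)"
  proof (rule integral_dominated_convergence[OF _ _ w])
    show "AE x in lborel. (\<lambda>n. (norm (u n x))\<^sup>2) \<longlonglongrightarrow> 0"
      using tendsto_power[OF tendsto_norm[OF lim], where n=2] by simp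
  qed (use bound in auto)
  then have "(\<lambda>n. sqrt (LINT x|lborel. (norm (u n x))\<^sup>2)) \<longlonglongrightarrow> sqrt 0"
    by (intro tendsto_real_sqrt) simp
  then show ?thesis by (simp add: L2_norm_def)
qed

lemma L2_spaceI:
  fixes u :: "'a::euclidean_space \<Rightarrow> complex"
  assumes [measurable]: "u \<in> borel_measurable borel"
    and w: "integrable lborel w" and bound: "\<And>x. (norm (u x))\<^sup>2 \<le> w x"
  shows "u \<in> L2_space"
proof -
  have "integrable lborel (\<lambda>x. (norm (u x))\<^sup>2)"
    by (rule Bochner_Integration.integrable_bound[OF w]) (use bound in \<open>auto intro: order_trans[OF _ abs_ge_self]\<close>)
  then show ?thesis by (simp add: L2_space_def)
qed

text \<open>The Gaussian has no zeros, so a truncation of f may be divided by it. The quotient is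
  continuous with compact support; approximating it by trigonometric polynomials and multiplying
  back gives packets. Truncation and approximation each cost half of \<epsilon>.\<close>

lemma wave_packets_dense:
  fixes f :: "'a::euclidean_space \<Rightarrow> complex"
  assumes h: "h > 0" and f: "f \<in> L2_space" "continuous_on UNIV f" and \<epsilon>: "\<epsilon> > 0"
  obtains n :: nat and c \<theta> where "L2_norm (\<lambda>x. f x - (\<Sum>i<n. c i * wave_packet h (\<theta> i) x)) < \<epsilon>"
proof -
  define \<gamma> where "\<gamma> x = complex_of_real (exp (- (norm x)\<^sup>2 / (2 * h)))" for x :: 'a
  have \<gamma>0: "\<gamma> x \<noteq> 0" for x by (simp add: \<gamma>_def)
  have \<gamma>_cont: "continuous_on UNIV \<gamma>" unfolding \<gamma>_def by (intro continuous_intros) (use h in auto)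
  have \<gamma>_sq: "(norm (\<gamma> x))\<^sup>2 = exp (- (1 / h) * (norm x)\<^sup>2)" for x
    by (simp add: \<gamma>_def exp_double[symmetric] divide_simps)
  define cut where "cut m x = max 0 (min 1 (real m + 1 - norm x))" for m and x :: 'a
  have cutoff: "0 \<le> cut m x" "cut m x \<le> 1" for m x by (auto simp: cut_def)
  have cutoff_cont: "continuous_on UNIV (cut m)" for m unfolding cut_def by (intro continuous_intros)
  have tail_meas: "(\<lambda>x. f x * complex_of_real (1 - cut m x)) \<in> borel_measurable borel" for m
    by (intro borel_measurable_continuous_onI continuous_intros f cutoff_cont)
  have tail_int: "integrable lborel (\<lambda>x. (norm (f x))\<^sup>2)" using f by (simp add: L2_space_def)
  have tail_bound: "(norm (f x * complex_of_real (1 - cut m x)))\<^sup>2 \<le> (norm (f x))\<^sup>2" for m x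
    unfolding norm_mult norm_of_real using cutoff[of m x] by (intro power_mono mult_left_le) auto
  have "(\<lambda>m. L2_norm (\<lambda>x. f x * complex_of_real (1 - cut m x))) \<longlonglongrightarrow> 0"
  proof (rule L2_norm_tendsto_0[OF tail_meas tail_int tail_bound])
    show "(\<lambda>m. f x * complex_of_real (1 - cut m x)) \<longlonglongrightarrow> 0" for x
    proof (rule tendsto_eventually)
      show "\<forall>\<^sub>F m in sequentially. f x * complex_of_real (1 - cut m x) = 0"
      proof (rule eventually_sequentiallyI[of "nat \<lceil>norm x\<rceil>"])
        fix m assume "nat \<lceil>norm x\<rceil> \<le> m"
        then have "norm x \<le> real m" by linarith
        then show "f x * complex_of_real (1 - cut m x) = 0" by (simp add: cut_def)
      qed
    qed
  qed
  then have "\<forall>\<^sub>F m in sequentially. L2_norm (\<lambda>x. f x * complex_of_real (1 - cut m x)) < \<epsilon> / 2"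
    using \<epsilon> by (intro order_tendstoD) auto
  then obtain m where m: "L2_norm (\<lambda>x. f x * complex_of_real (1 - cut m x)) < \<epsilon> / 2"
    by (auto simp: eventually_sequentially)
  define g where "g x = f x * complex_of_real (cut m x) / \<gamma> x" for x
  have g_cont: "continuous_on UNIV g"
    unfolding g_def by (intro continuous_intros f cutoff_cont \<gamma>_cont) (simp add: \<gamma>0)
  have "g x = 0" if "norm x > real m + 1" for x using that by (simp add: g_def cut_def)
  from trig_fun_approx[OF g_cont this] obtain q B where
    q: "\<And>n::nat. trig_fun (q n)" "\<And>n x. norm (q n x) \<le> B" "\<And>x. (\<lambda>n. q n x) \<longlonglongrightarrow> g x" by blast
  have gB: "norm (g x) \<le> B" for x
    by (rule Lim_norm_ubound[OF _ q(3)]) (auto simp: q(2))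
  have q_cont: "continuous_on UNIV (q n)" for n by (rule trig_fun_continuous[OF q(1)])
  have diff_meas: "(\<lambda>x. \<gamma> x * (g x - q n x)) \<in> borel_measurable borel" for n
    by (intro borel_measurable_continuous_onI continuous_intros g_cont q_cont \<gamma>_cont)
  have diff_int: "integrable lborel (\<lambda>x::'a. exp (- (1 / h) * (norm x)\<^sup>2) * (2 * B)\<^sup>2)"
  proof -
    have "integrable lborel (\<lambda>x::'a. Re (complex_of_real (exp (- (1 / h) * (norm (x - 0))\<^sup>2))))"
      using h by (intro integrable_Re gaussian_shifted) auto
    then have "integrable lborel (\<lambda>x::'a. exp (- (1 / h) * (norm x)\<^sup>2))" by (simp only: Re_complex_of_real diff_zero)
    then show ?thesis by (rule integrable_mult_left)
  qed
  have diff_bound: "(norm (\<gamma> x * (g x - q n x)))\<^sup>2 \<le> exp (- (1 / h) * (norm x)\<^sup>2) * (2 * B)\<^sup>2" for n x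
  proof -
    have "norm (g x - q n x) \<le> 2 * B"
      using norm_triangle_ineq4[of "g x" "q n x"] gB[of x] q(2)[of n x] by simp
    then show ?thesis
      unfolding norm_mult power_mult_distrib \<gamma>_sq[symmetric]
      unfolding power_mult_distrib[symmetric] by (intro power_mono mult_left_mono) auto
  qed
  have "(\<lambda>n. L2_norm (\<lambda>x. \<gamma> x * (g x - q n x))) \<longlonglongrightarrow> 0"
  proof (rule L2_norm_tendsto_0[OF diff_meas diff_int diff_bound])
    have "(\<lambda>n. \<gamma> x * (g x - q n x)) \<longlonglongrightarrow> \<gamma> x * (g x - g x)" for x
      by (intro tendsto_intros q)
    then show "(\<lambda>n. \<gamma> x * (g x - q n x)) \<longlonglongrightarrow> 0" for x by simp
  qed
  then have "\<forall>\<^sub>F n in sequentially. L2_norm (\<lambda>x. \<gamma> x * (g x - q n x)) < \<epsilon> / 2"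
    using \<epsilon> by (intro order_tendstoD) auto
  then obtain n where n: "L2_norm (\<lambda>x. \<gamma> x * (g x - q n x)) < \<epsilon> / 2"
    by (auto simp: eventually_sequentially)
  obtain k c \<theta> where rep: "q n = (\<lambda>x. \<Sum>i<(k::nat). c i * cis (\<theta> i \<bullet> x))"
    using trig_fun_representation[OF q(1)] by blast
  have packet: "\<gamma> x * q n x = (\<Sum>i<k. c i * wave_packet h (\<theta> i) x)" for x
    unfolding rep \<gamma>_def wave_packet_def sum_distrib_left by (intro sum.cong) (simp_all add: mult_ac)
  have split: "f x - (\<Sum>i<k. c i * wave_packet h (\<theta> i) x) =
      f x * complex_of_real (1 - cut m x) + \<gamma> x * (g x - q n x)" for x
    using \<gamma>0[of x] by (simp add: packet[symmetric] g_def algebra_simps)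
  note in_L2 = L2_spaceI[OF tail_meas tail_int tail_bound] L2_spaceI[OF diff_meas diff_int diff_bound]
  have "L2_norm (\<lambda>x. f x - (\<Sum>i<k. c i * wave_packet h (\<theta> i) x)) < \<epsilon>"
    unfolding split using L2_norm_triangle[OF in_L2(1)[of m] in_L2(2)[of n]] m n by linarith
  then show ?thesis by (rule that)
qed

section \<open>Approximation by monotone polynomials\<close>

text \<open>The derivative is a Bernstein sum in the forward differences of \<phi>. Hence monotone
  data produce monotone polynomials, which is why this approximation scheme is chosen.\<close>

lemma Bernstein_sum_has_derivative:
  fixes \<phi> :: "nat \<Rightarrow> real"
  shows "((\<lambda>x. \<Sum>k\<le>Suc n. \<phi> k * Bernstein (Suc n) k x) has_real_derivative
     (real (Suc n) * (\<Sum>k\<le>n. (\<phi> (Suc k) - \<phi> k) * Bernstein n k x))) (at x)"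
proof -
  have D0: "((\<lambda>x. Bernstein (Suc n) 0 x) has_real_derivative - (real (Suc n) * Bernstein n 0 x)) (at x)"
  proof -
    have "((\<lambda>x. 1 - x) has_real_derivative - 1) (at x)" by (auto intro!: derivative_eq_intros)
    from DERIV_power[OF this, of "Suc n"] show ?thesis by (simp add: Bernstein_def)
  qed
  have D: "((\<lambda>x. Bernstein (Suc n) (Suc k) x) has_real_derivative
      real (Suc n) * (Bernstein n k x - (if k < n then Bernstein n (Suc k) x else 0))) (at x)" if "k \<le> n" for k
  proof -
    have 1: "real (Suc n choose Suc k) * real (Suc k) = real (Suc n) * real (n choose k)"
      using Suc_times_binomial_eq[of n k] by (metis of_nat_mult)
    have 2: "real (Suc n choose Suc k) * real (n - k) = real (Suc n) * real (n choose Suc k)"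
    proof -
      have "(Suc n choose Suc k) * (n - k) = Suc n * (n choose Suc k)"
        using binomial_absorb_comp[of "Suc n" "Suc k"] by (simp add: mult.commute)
      then show ?thesis by (metis of_nat_mult)
    qed
    have "((\<lambda>x. Bernstein (Suc n) (Suc k) x) has_real_derivative
       (real (Suc n choose Suc k) * real (Suc k)) * x ^ k * (1 - x) ^ (n - k)
       - (real (Suc n choose Suc k) * real (n - k)) * x ^ Suc k * (1 - x) ^ (n - Suc k)) (at x)"
    proof -
      have "((\<lambda>x. 1 - x) has_real_derivative - 1) (at x)" by (auto intro!: derivative_eq_intros)
      note DERIV_mult[OF DERIV_pow[of "Suc k"] DERIV_power[OF this, of "n - k"]]
      from DERIV_cmult[OF this, of "real (Suc n choose Suc k)"] show ?thesis
        by (simp add: Bernstein_def mult.assoc algebra_simps del: binomial_Suc_Suc)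
    qed
    then show ?thesis
      unfolding 1 2 using that by (auto simp: Bernstein_def algebra_simps binomial_eq_0 simp del: binomial_Suc_Suc)
  qed
  have "((\<lambda>x. \<Sum>k\<le>Suc n. \<phi> k * Bernstein (Suc n) k x) has_real_derivative
     (\<phi> 0 * - (real (Suc n) * Bernstein n 0 x) +
      (\<Sum>k\<le>n. \<phi> (Suc k) * (real (Suc n) * (Bernstein n k x - (if k < n then Bernstein n (Suc k) x else 0)))))) (at x)"
    unfolding sum.atMost_Suc_shift by (intro DERIV_add DERIV_sum DERIV_cmult D0 D) auto
  also have "(\<phi> 0 * - (real (Suc n) * Bernstein n 0 x) +
      (\<Sum>k\<le>n. \<phi> (Suc k) * (real (Suc n) * (Bernstein n k x - (if k < n then Bernstein n (Suc k) x else 0)))))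
     = real (Suc n) * ((\<Sum>k\<le>n. \<phi> (Suc k) * Bernstein n k x)
        - (\<phi> 0 * Bernstein n 0 x + (\<Sum>k\<le>n. \<phi> (Suc k) * (if k < n then Bernstein n (Suc k) x else 0))))"
    by (simp add: algebra_simps sum_distrib_left sum_subtractf sum.distrib)
  also have "\<phi> 0 * Bernstein n 0 x + (\<Sum>k\<le>n. \<phi> (Suc k) * (if k < n then Bernstein n (Suc k) x else 0))
     = (\<Sum>k\<le>n. \<phi> k * Bernstein n k x)"
  proof -
    have "(\<Sum>k\<le>n. \<phi> (Suc k) * (if k < n then Bernstein n (Suc k) x else 0)) = (\<Sum>k<n. \<phi> (Suc k) * Bernstein n (Suc k) x)"
      unfolding lessThan_Suc_atMost[symmetric] sum.lessThan_Suc by simp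
    then show ?thesis by (simp add: sum.atMost_shift)
  qed
  finally show ?thesis by (simp add: sum_subtractf left_diff_distrib)
qed

definition Bernstein_poly :: "nat \<Rightarrow> nat \<Rightarrow> real poly" where
  "Bernstein_poly n k = smult (real (n choose k)) ([:0, 1:] ^ k * [:1, - 1:] ^ (n - k))"

lemma poly_Bernstein_poly: "poly (Bernstein_poly n k) x = Bernstein n k x"
  by (simp add: Bernstein_poly_def Bernstein_def poly_power mult.assoc)

lemma antimono_poly_approx:
  fixes \<phi> :: "real \<Rightarrow> real"
  assumes cont: "continuous_on {0..1} \<phi>" and anti: "antimono_on {0..1} \<phi>" and \<epsilon>: "\<epsilon> > 0"
  obtains q :: "real poly" where "\<And>x. 0 \<le> x \<Longrightarrow> x \<le> 1 \<Longrightarrow> poly (pderiv q) x \<le> 0"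
    "\<And>x. 0 \<le> x \<Longrightarrow> x \<le> 1 \<Longrightarrow> \<bar>\<phi> x - poly q x\<bar> < \<epsilon>"
proof -
  obtain M where M: "\<forall>n x. M \<le> n \<and> x \<in> {0..1} \<longrightarrow> \<bar>\<phi> x - (\<Sum>k\<le>n. \<phi> (real k / real n) * Bernstein n k x)\<bar> < \<epsilon>"
    using Bernstein_Weierstrass[OF cont \<epsilon>] by blast
  \<comment> \<open>The degree \<open>Suc M\<close> is used so that the derivative formula applies,
    with Bernstein polynomials of degree \<open>M\<close>.\<close>
  define \<psi> where "\<psi> k = \<phi> (real k / real (Suc M))" for k
  define q where "q = (\<Sum>k\<le>Suc M. smult (\<psi> k) (Bernstein_poly (Suc M) k))"
  have q: "poly q x = (\<Sum>k\<le>Suc M. \<psi> k * Bernstein (Suc M) k x)" for x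
    by (simp add: q_def poly_sum poly_Bernstein_poly)
  show ?thesis
  proof (rule that[of q])
    fix x :: real assume x: "0 \<le> x" "x \<le> 1"
    have "(poly q has_real_derivative real (Suc M) * (\<Sum>k\<le>M. (\<psi> (Suc k) - \<psi> k) * Bernstein M k x)) (at x)"
      unfolding q[abs_def] by (rule Bernstein_sum_has_derivative)
    then have "poly (pderiv q) x = real (Suc M) * (\<Sum>k\<le>M. (\<psi> (Suc k) - \<psi> k) * Bernstein M k x)"
      using poly_DERIV DERIV_unique by blast
    also have "\<dots> \<le> 0"
    proof (rule mult_nonneg_nonpos[OF _ sum_nonpos], simp, rule mult_nonpos_nonneg)
      fix k assume k: "k \<in> {..M}"
      have "\<psi> (Suc k) \<le> \<psi> k"
        unfolding \<psi>_def using k by (intro monotone_onD[OF anti]) (auto intro!: divide_right_mono simp: divide_le_eq_1)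
      then show "\<psi> (Suc k) - \<psi> k \<le> 0" by simp
      show "0 \<le> Bernstein M k x" using x by (rule Bernstein_nonneg)
    qed
    finally show "poly (pderiv q) x \<le> 0" .
    show "\<bar>\<phi> x - poly q x\<bar> < \<epsilon>"
      using M[rule_format, of "Suc M" x] x by (simp add: q \<psi>_def)
  qed
qed

section \<open>From the half line to the unit interval\<close>

lemma mono_on_tendsto_SUP_at_top:
  fixes \<Phi> :: "real \<Rightarrow> real"
  assumes mono: "mono_on {0..} \<Phi>" and bdd: "\<And>t. t \<ge> 0 \<Longrightarrow> \<Phi> t \<le> B"
  shows "(\<Phi> \<longlongrightarrow> (SUP t\<in>{0..}. \<Phi> t)) at_top"
proof (rule order_tendstoI)
  have bdd': "bdd_above (\<Phi> ` {0..})" using bdd by (auto intro: bdd_aboveI[of _ B])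
  fix a assume "a < (SUP t\<in>{0..}. \<Phi> t)"
  then obtain t where t: "t \<ge> 0" "a < \<Phi> t" using less_cSUP_iff[OF _ bdd'] by auto
  show "\<forall>\<^sub>F x in at_top. a < \<Phi> x"
    using eventually_ge_at_top[of t]
  proof eventually_elim
    case (elim x)
    then have "\<Phi> t \<le> \<Phi> x" using t by (intro mono_onD[OF mono]) auto
    then show ?case using t by simp
  qed
next
  have bdd': "bdd_above (\<Phi> ` {0..})" using bdd by (auto intro: bdd_aboveI[of _ B])
  fix a assume a: "(SUP t\<in>{0..}. \<Phi> t) < a"
  show "\<forall>\<^sub>F x in at_top. \<Phi> x < a"
    using eventually_ge_at_top[of 0]
  proof eventually_elim
    case (elim x)
    then show ?case using cSUP_upper[OF _ bdd', of x] a by auto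
  qed
qed

text \<open>The substitution x = exp (-t / h) maps the half line to (0, 1] and reverses
  monotonicity. The limit S of \<Phi> at infinity, which exists because \<Phi> is monotone and
  bounded, is the value at x = 0 that makes the transformed function continuous on the closed
  interval.\<close>

lemma mono_exp_poly_approx:
  fixes \<Phi> :: "real \<Rightarrow> real"
  assumes h: "h > 0" and cont: "continuous_on {0..} \<Phi>" and mono: "mono_on {0..} \<Phi>"
    and bdd: "\<And>t. t \<ge> 0 \<Longrightarrow> \<Phi> t \<le> B" and \<epsilon>: "\<epsilon> > 0"
  obtains q :: "real poly" where "\<And>x. 0 \<le> x \<Longrightarrow> x \<le> 1 \<Longrightarrow> poly (pderiv q) x \<le> 0"
    "\<And>t. 0 \<le> t \<Longrightarrow> \<bar>\<Phi> t - poly q (exp (- t / h))\<bar> < \<epsilon>"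
proof -
  define S where "S = (SUP t\<in>{0..}. \<Phi> t)"
  have lim: "(\<Phi> \<longlongrightarrow> S) at_top"
    unfolding S_def by (rule mono_on_tendsto_SUP_at_top[OF mono bdd])
  have le_S: "\<Phi> t \<le> S" if "t \<ge> 0" for t
    unfolding S_def using that bdd by (intro cSUP_upper) (auto intro: bdd_aboveI[of _ B])
  define \<phi> where "\<phi> x = (if x = 0 then S else \<Phi> (- h * ln x))" for x
  have nonneg: "- h * ln x \<ge> 0" if "0 < x" "x \<le> 1" for x :: real
    using that h by (simp add: mult_nonneg_nonpos)
  have "continuous_on {0..1} \<phi>"
    unfolding continuous_on_eq_continuous_within
  proof
    fix x :: real assume x: "x \<in> {0..1}"
    show "continuous (at x within {0..1}) \<phi>"
    proof (cases "x = 0")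
      case True
      have "filterlim (\<lambda>x. - h * ln x) at_top (at_right 0)"
        using filterlim_tendsto_pos_mult_at_top[OF tendsto_const h ln_at_0[THEN filterlim_uminus_at_bot[THEN iffD1]]]
        by simp
      then have "((\<lambda>x. \<Phi> (- h * ln x)) \<longlongrightarrow> S) (at_right 0)"
        by (rule filterlim_compose[OF lim])
      then have "((\<lambda>x. \<Phi> (- h * ln x)) \<longlongrightarrow> S) (at 0 within {0..1})"
        by (subst (asm) at_within_Icc_at_right[symmetric, of 0 1]) auto
      then have "(\<phi> \<longlongrightarrow> S) (at 0 within {0..1})"
        by (rule Lim_transform_eventually) (auto simp: \<phi>_def eventually_at_filter)
      then show ?thesis using True by (simp add: continuous_within \<phi>_def)
    next
      case False
      have "continuous_on {0<..1} (\<lambda>x. \<Phi> (- h * ln x))"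
        by (intro continuous_on_compose2[OF cont] continuous_intros) (use nonneg in auto)
      then have "continuous (at x within {0<..1}) (\<lambda>x. \<Phi> (- h * ln x))"
        using x False by (simp add: continuous_on_eq_continuous_within)
      moreover have "at x within {0<..1} = at x within {0..1}"
        using x False by (intro at_within_nhd[of x "{0<..}"]) auto
      ultimately have "((\<lambda>x. \<Phi> (- h * ln x)) \<longlongrightarrow> \<phi> x) (at x within {0..1})"
        using False by (simp add: continuous_within \<phi>_def)
      moreover have "\<forall>\<^sub>F y in at x within {0..1}. \<Phi> (- h * ln y) = \<phi> y"
        unfolding eventually_at_topological using x False by (intro exI[of _ "{0<..}"]) (auto simp: \<phi>_def)
      ultimately show ?thesis
        unfolding continuous_within by (rule Lim_transform_eventually)
    qed
  qed
  moreover have "antimono_on {0..1} \<phi>"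
  proof (rule monotone_onI)
    fix x y :: real assume xy: "x \<in> {0..1}" "y \<in> {0..1}" "x \<le> y"
    show "\<phi> x \<ge> \<phi> y"
    proof (cases "x = 0")
      case True
      then show ?thesis using le_S nonneg[of y] xy by (auto simp: \<phi>_def)
    next
      case False
      then have "- h * ln y \<le> - h * ln x" using xy h by (auto intro!: mult_left_mono)
      then have "\<Phi> (- h * ln y) \<le> \<Phi> (- h * ln x)"
        using False xy nonneg[of x] nonneg[of y] by (intro mono_onD[OF mono]) auto
      then show ?thesis using False xy by (auto simp: \<phi>_def)
    qed
  qed
  ultimately obtain q where q: "\<And>x. 0 \<le> x \<Longrightarrow> x \<le> 1 \<Longrightarrow> poly (pderiv q) x \<le> 0"
    "\<And>x. 0 \<le> x \<Longrightarrow> x \<le> 1 \<Longrightarrow> \<bar>\<phi> x - poly q x\<bar> < \<epsilon>"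
    using antimono_poly_approx[OF _ _ \<epsilon>] by blast
  show ?thesis
  proof (rule that[of q])
    show "\<bar>\<Phi> t - poly q (exp (- t / h))\<bar> < \<epsilon>" if "0 \<le> t" for t
    proof -
      have "\<phi> (exp (- t / h)) = \<Phi> t" using h by (simp add: \<phi>_def)
      moreover have "exp (- t / h) \<le> 1" using h that by simp
      ultimately show ?thesis using q(2)[of "exp (- t / h)"] by simp
    qed
  qed (use q in blast)
qed

lemma exponential_poly_integral:
  assumes h: "h > 0"
  shows "set_integrable lborel {0..} (\<lambda>t. poly q (exp (- t / h)) * exp (- t / h))"
    and "1 / h * (LINT t:{0..}|lborel. poly q (exp (- t / h)) * exp (- t / h)) = coeff_pairing (\<lambda>c. 1 / c) q"
proof -
  have exp: "set_integrable lborel {0..} (\<lambda>t. exp (- (real k + 1) / h * t))"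
    "(LINT t:{0..}|lborel. exp (- (real k + 1) / h * t)) = h / (real k + 1)" for k
  proof -
    define c where "c = (real k + 1) / h"
    have c: "c > 0" using h by (simp add: c_def)
    have deriv: "((\<lambda>t. - exp (- c * t) / c) has_real_derivative exp (- c * t)) (at t)" for t
      using c by (auto intro!: derivative_eq_intros)
    have "((\<lambda>t. exp (- (c * t))) \<longlongrightarrow> 0) at_top"
      by (intro filterlim_compose[OF exp_at_bot] filterlim_uminus_at_top[THEN iffD1]
          filterlim_tendsto_pos_mult_at_top[OF tendsto_const c] filterlim_ident)
    then have "((\<lambda>t. - exp (- (c * t)) / c) \<longlongrightarrow> - 0 / c) at_top"
      by (intro tendsto_divide tendsto_minus tendsto_const) (use c in auto)
    then have lim: "((\<lambda>t. - exp (- c * t) / c) \<longlongrightarrow> 0) at_top"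
      by simp
    have "(\<integral>\<^sup>+t. ennreal (exp (- c * t)) * indicator {0..} t \<partial>lborel) = ennreal (0 - - exp (- c * 0) / c)"
      by (rule nn_integral_FTC_atLeast[OF _ deriv _ lim]) auto
    then have "(\<integral>\<^sup>+t. ennreal (indicator {0..} t *\<^sub>R exp (- c * t)) \<partial>lborel) = ennreal (1 / c)"
      by (simp add: indicator_mult_ennreal mult.commute)
    then have int: "set_integrable lborel {0..} (\<lambda>t. exp (- c * t))"
      unfolding set_integrable_def by (intro integrableI_nn_integral_finite[where x = "1 / c"]) auto
    have "(LINT t:{0..}|lborel. exp (- c * t)) = 0 - - exp (- c * 0) / c"
      by (rule set_integral_FTC_atLeast[OF deriv _ int lim]) (intro continuous_intros)
    then show "set_integrable lborel {0..} (\<lambda>t. exp (- (real k + 1) / h * t))"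
      "(LINT t:{0..}|lborel. exp (- (real k + 1) / h * t)) = h / (real k + 1)"
      using int by (simp_all only: c_def minus_divide_left) simp
  qed
  have eq: "poly q (exp (- t / h)) * exp (- t / h) = (\<Sum>k\<le>degree q. coeff q k * exp (- (real k + 1) / h * t))" for t
  proof -
    have "exp (- t / h) ^ k * exp (- t / h) = exp (- (real k + 1) / h * t)" for k
      unfolding exp_of_nat_mult[symmetric] mult_exp_exp using h by (simp add: divide_simps) (simp add: algebra_simps)
    then show ?thesis by (simp add: poly_altdef sum_distrib_right mult.assoc)
  qed
  have int: "set_integrable lborel {0..} (\<lambda>t. coeff q k * exp (- (real k + 1) / h * t))" for k
    by (rule set_integrable_mult_right) (rule exp(1))
  show "set_integrable lborel {0..} (\<lambda>t. poly q (exp (- t / h)) * exp (- t / h))"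
    using int unfolding eq set_integrable_def scaleR_sum_right by (intro Bochner_Integration.integrable_sum)
  have "(LINT t:{0..}|lborel. poly q (exp (- t / h)) * exp (- t / h)) = (\<Sum>k\<le>degree q. coeff q k * (h / (real k + 1)))"
    using int unfolding eq set_lebesgue_integral_def set_integrable_def scaleR_sum_right
    by (subst Bochner_Integration.integral_sum)
       (simp_all only: set_lebesgue_integral_def[symmetric] set_integral_mult_right exp(2))
  then show "1 / h * (LINT t:{0..}|lborel. poly q (exp (- t / h)) * exp (- t / h)) = coeff_pairing (\<lambda>c. 1 / c) q"
    using h by (simp add: coeff_pairing_def sum_distrib_left)
qed

text \<open>Taking the identity as operator lets the expansion and perturbation results for
  quadratic forms serve the squared norm as well.\<close>

lemma bounded_L2_operator_id: "bounded_L2_operator (\<lambda>f. f)"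
  unfolding bounded_L2_operator_def by (auto intro!: exI[of _ 1])

section \<open>The quadratic form\<close>

text \<open>A Schur product argument: one factor \<theta> i \<bullet> \<theta> j is expanded over
  the basis and its coordinates are absorbed into the coefficients, leaving forms of order N with
  new coefficients. The induction therefore varies c; for exponent 0 the form is the squared modulus
  of the sum of the coefficients.\<close>

lemma gram_power_nonneg:
  fixes \<theta> :: "nat \<Rightarrow> 'a::euclidean_space"
  shows "\<exists>r\<ge>0. (\<Sum>i<n. \<Sum>j<n. c i * cnj (c j) * complex_of_real ((\<theta> i \<bullet> \<theta> j) ^ N)) = complex_of_real r"
proof (induction N arbitrary: c)
  case 0
  have "(\<Sum>i<n. \<Sum>j<n. c i * cnj (c j) * complex_of_real ((\<theta> i \<bullet> \<theta> j) ^ 0)) = (\<Sum>i<n. c i) * cnj (\<Sum>i<n. c i)"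
    by (simp add: sum_product)
  also have "\<dots> = complex_of_real ((norm (\<Sum>i<n. c i))\<^sup>2)"
    by (rule complex_norm_square[symmetric])
  finally show ?case by (intro exI[of _ "(norm (\<Sum>i<n. c i))\<^sup>2"]) simp
next
  case (Suc N)
  define S where "S b = (\<Sum>i<n. \<Sum>j<n. (c i * complex_of_real (\<theta> i \<bullet> b)) * cnj (c j * complex_of_real (\<theta> j \<bullet> b)) *
      complex_of_real ((\<theta> i \<bullet> \<theta> j) ^ N))" for b
  have "\<exists>r\<ge>0. S b = complex_of_real r" for b
    unfolding S_def by (rule Suc)
  then have S: "S b = complex_of_real (Re (S b))" "0 \<le> Re (S b)" for b
    by (metis Re_complex_of_real)+
  have "(\<Sum>i<n. \<Sum>j<n. c i * cnj (c j) * complex_of_real ((\<theta> i \<bullet> \<theta> j) ^ Suc N)) =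
    (\<Sum>i<n. \<Sum>j<n. \<Sum>b\<in>Basis. (c i * complex_of_real (\<theta> i \<bullet> b)) * cnj (c j * complex_of_real (\<theta> j \<bullet> b)) *
      complex_of_real ((\<theta> i \<bullet> \<theta> j) ^ N))"
  proof (intro sum.cong refl)
    fix i j
    have "complex_of_real ((\<theta> i \<bullet> \<theta> j) ^ Suc N) = (\<Sum>b\<in>Basis. complex_of_real (\<theta> i \<bullet> b) * complex_of_real (\<theta> j \<bullet> b)) * complex_of_real ((\<theta> i \<bullet> \<theta> j) ^ N)"
      unfolding power_Suc of_real_mult by (subst euclidean_inner[of "\<theta> i" "\<theta> j"]) simp
    then show "c i * cnj (c j) * complex_of_real ((\<theta> i \<bullet> \<theta> j) ^ Suc N) =
      (\<Sum>b\<in>Basis. (c i * complex_of_real (\<theta> i \<bullet> b)) * cnj (c j * complex_of_real (\<theta> j \<bullet> b)) * complex_of_real ((\<theta> i \<bullet> \<theta> j) ^ N))"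
      unfolding sum_distrib_right by (simp only: sum_distrib_left) (simp add: mult_ac)
  qed
  also have "\<dots> = (\<Sum>b\<in>Basis. \<Sum>i<n. \<Sum>j<n. (c i * complex_of_real (\<theta> i \<bullet> b)) * cnj (c j * complex_of_real (\<theta> j \<bullet> b)) *
      complex_of_real ((\<theta> i \<bullet> \<theta> j) ^ N))"
    by (rule trans[OF sum.cong[OF refl sum.swap] sum.swap])
  also have "\<dots> = complex_of_real (\<Sum>b\<in>Basis. Re (S b))"
    unfolding S_def[symmetric] of_real_sum using S(1) by (intro sum.cong) auto
  finally show ?case using S(2) by (intro exI[of _ "\<Sum>b\<in>Basis. Re (S b)"]) (auto intro: sum_nonneg)
qed

section \<open>Expansion and perturbation of operator forms\<close>

lemma L2_space_lincomb:
  fixes w :: "nat \<Rightarrow> 'b::euclidean_space \<Rightarrow> complex"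
  assumes "\<And>i. w i \<in> L2_space"
  shows "(\<lambda>x. \<Sum>i<n. c i * w i x) \<in> L2_space"
proof (induction n)
  case 0
  show ?case by (simp add: L2_space_def)
next
  case (Suc n)
  then show ?case using L2_space_add[OF Suc L2_space_cmult[OF assms]] by simp
qed

lemma L2_inner_lincomb_right:
  assumes w: "\<And>i. w i \<in> L2_space" and k: "k \<in> L2_space"
  shows "L2_inner k (\<lambda>x. \<Sum>i<(n::nat). c i * w i x) = (\<Sum>i<n. cnj (c i) * L2_inner k (w i))"
proof (induction n)
  case 0
  show ?case by (simp add: L2_inner_def)
next
  case (Suc n)
  then show ?case
    using L2_inner_add_right[OF L2_space_lincomb[OF w] L2_space_cmult[OF w] k]
    by (simp add: L2_inner_cmult_right)
qed

context
  fixes A :: "('a::euclidean_space \<Rightarrow> complex) \<Rightarrow> 'a \<Rightarrow> complex"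
  assumes A: "bounded_L2_operator A"
begin

lemma operator_L2_space: "f \<in> L2_space \<Longrightarrow> A f \<in> L2_space"
  using A by (auto simp: bounded_L2_operator_def)

lemma L2_inner_operator_add:
  assumes "f \<in> L2_space" "g \<in> L2_space" "k \<in> L2_space"
  shows "L2_inner (A (\<lambda>x. f x + g x)) k = L2_inner (A f) k + L2_inner (A g) k"
proof -
  have "AE x in lborel. A (\<lambda>y. f y + g y) x = A f x + A g x"
    using A assms by (auto simp: bounded_L2_operator_def)
  then have "L2_inner (A (\<lambda>x. f x + g x)) k = L2_inner (\<lambda>x. A f x + A g x) k"
    by (rule L2_inner_AE_cong_left) (use assms operator_L2_space L2_space_add in auto)
  then show ?thesis
    by (simp add: L2_inner_add_left assms operator_L2_space)
qed

lemma L2_inner_operator_cmult: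
  assumes "f \<in> L2_space" "k \<in> L2_space"
  shows "L2_inner (A (\<lambda>x. c * f x)) k = c * L2_inner (A f) k"
proof -
  have "AE x in lborel. A (\<lambda>y. c * f y) x = c * A f x"
    using A assms by (auto simp: bounded_L2_operator_def)
  then have "L2_inner (A (\<lambda>x. c * f x)) k = L2_inner (\<lambda>x. c * A f x) k"
    by (rule L2_inner_AE_cong_left) (use assms operator_L2_space L2_space_cmult in auto)
  then show ?thesis by (simp add: L2_inner_cmult_left)
qed

lemma L2_inner_operator_lincomb:
  assumes w: "\<And>i. w i \<in> L2_space" and k: "k \<in> L2_space"
  shows "L2_inner (A (\<lambda>x. \<Sum>i<(n::nat). c i * w i x)) k = (\<Sum>i<n. c i * L2_inner (A (w i)) k)"
proof (induction n)
  case 0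
  \<comment> \<open>The empty combination is handled as 0 times \<open>w 0\<close>.\<close>
  show ?case using L2_inner_operator_cmult[OF w[of 0] k, of 0] by simp
next
  case (Suc n)
  then show ?case
    using L2_inner_operator_add[OF L2_space_lincomb[OF w] L2_space_cmult[OF w] k]
      L2_inner_operator_cmult[OF w k] by simp
qed

lemma L2_inner_operator_lincomb_both:
  assumes w: "\<And>i. w i \<in> L2_space"
  shows "L2_inner (A (\<lambda>x. \<Sum>i<(n::nat). c i * w i x)) (\<lambda>x. \<Sum>i<n. c i * w i x) =
    (\<Sum>i<n. \<Sum>j<n. c i * cnj (c j) * L2_inner (A (w i)) (w j))"
  by (simp add: L2_inner_operator_lincomb[OF w L2_space_lincomb[OF w]]
      L2_inner_lincomb_right[OF w operator_L2_space[OF w]] sum_distrib_left mult.assoc)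

text \<open>With f = u + r the difference is <A u, r> + <A r, f>. Since \<delta> is at most 1, the
  norm of u is at most that of f plus 1, so the bound is linear in \<delta> with a constant
  independent of u.\<close>

lemma L2_inner_operator_perturb:
  assumes f: "f \<in> L2_space" and u: "u \<in> L2_space" and C: "C \<ge> 0" "\<And>f. f \<in> L2_space \<Longrightarrow> L2_norm (A f) \<le> C * L2_norm f"
    and \<delta>: "L2_norm (\<lambda>x. f x - u x) \<le> \<delta>" "\<delta> \<le> 1"
  shows "norm (L2_inner (A f) f - L2_inner (A u) u) \<le> C * (2 * L2_norm f + 1) * \<delta>"
proof -
  define r where "r x = f x - u x" for x
  have r: "r \<in> L2_space"
    using L2_space_add[OF f L2_space_cmult[OF u, of "-1"]] by (simp add: r_def[abs_def])
  have r\<delta>: "L2_norm r \<le> \<delta>" using \<delta> by (simp add: r_def[abs_def])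
  have split: "(\<lambda>x. u x + r x) = f" by (simp add: r_def fun_eq_iff)
  have "L2_norm u \<le> L2_norm f + L2_norm (\<lambda>x. - 1 * r x)"
    using L2_norm_triangle[OF f L2_space_cmult[OF r, of "- 1"]] by (simp add: r_def)
  also have "L2_norm (\<lambda>x. - 1 * r x) = L2_norm r" by (simp add: L2_norm_def)
  finally have u_le: "L2_norm u \<le> L2_norm f + 1" using r\<delta> \<delta> by simp
  have "L2_inner (A f) f = L2_inner (A u) u + L2_inner (A u) r + L2_inner (A r) f"
    using L2_inner_operator_add[OF u r f] L2_inner_add_right[OF u r operator_L2_space[OF u]]
    by (simp add: split)
  then have "norm (L2_inner (A f) f - L2_inner (A u) u) \<le> norm (L2_inner (A u) r) + norm (L2_inner (A r) f)"
    using norm_triangle_ineq[of "L2_inner (A u) r" "L2_inner (A r) f"] by simp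
  also have "\<dots> \<le> L2_norm (A u) * L2_norm r + L2_norm (A r) * L2_norm f"
    by (intro add_mono L2_inner_norm_le operator_L2_space u r f)
  also have "\<dots> \<le> (C * (L2_norm f + 1)) * \<delta> + (C * \<delta>) * L2_norm f"
  proof (intro add_mono mult_mono r\<delta> L2_norm_nonneg order_refl)
    show "L2_norm (A u) \<le> C * (L2_norm f + 1)"
      using C(2)[OF u] mult_left_mono[OF u_le C(1)] by linarith
    show "L2_norm (A r) \<le> C * \<delta>"
      using C(2)[OF r] mult_left_mono[OF r\<delta> C(1)] by linarith
    have "0 \<le> \<delta>" using r\<delta> L2_norm_nonneg[of r] by linarith
    then show "0 \<le> C * (L2_norm f + 1)" "0 \<le> C * \<delta>" using C(1) L2_norm_nonneg[of f] by auto
  qed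
  also have "\<dots> = C * (2 * L2_norm f + 1) * \<delta>" by (simp add: algebra_simps)
  finally show ?thesis .
qed

end

section \<open>Quadratic forms of packet combinations\<close>

lemma integrable_bounded_mult:
  fixes W :: "'a::euclidean_space \<Rightarrow> complex" and g :: "'a \<Rightarrow> real"
  assumes W: "integrable lborel W" and [measurable]: "g \<in> borel_measurable borel" and B: "\<And>Z. \<bar>g Z\<bar> \<le> B"
  shows "integrable lborel (\<lambda>Z. complex_of_real (g Z) * W Z)"
proof (rule Bochner_Integration.integrable_bound)
  show "integrable lborel (\<lambda>Z. B * norm (W Z))" using W by auto
  have [measurable]: "W \<in> borel_measurable borel" using borel_measurable_integrable[OF W] by simp
  show "(\<lambda>Z. complex_of_real (g Z) * W Z) \<in> borel_measurable lborel" by measurable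
  show "AE Z in lborel. norm (complex_of_real (g Z) * W Z) \<le> norm (B * norm (W Z))"
  proof (intro AE_I2)
    fix Z
    have "\<bar>g Z\<bar> \<le> \<bar>B\<bar>" using B[of Z] by simp
    then show "norm (complex_of_real (g Z) * W Z) \<le> norm (B * norm (W Z))"
      by (simp add: norm_mult abs_mult mult_right_mono)
  qed
qed

lemma integral_bounded_mult_le:
  fixes W :: "'a::euclidean_space \<Rightarrow> complex" and g :: "'a \<Rightarrow> real"
  assumes W: "integrable lborel W" and g: "g \<in> borel_measurable borel" and B: "\<And>Z. \<bar>g Z\<bar> \<le> B"
  shows "norm (LINT Z|lborel. complex_of_real (g Z) * W Z) \<le> B * (LINT Z|lborel. norm (W Z))"
proof -
  have "norm (LINT Z|lborel. complex_of_real (g Z) * W Z) \<le> (LINT Z|lborel. norm (complex_of_real (g Z) * W Z))"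
    by (rule integral_norm_bound)
  also have "\<dots> \<le> (LINT Z|lborel. B * norm (W Z))"
    by (rule integral_mono)
       (use integrable_norm[OF integrable_bounded_mult[OF assms]] W B in \<open>auto simp: norm_mult intro!: mult_right_mono\<close>)
  finally show ?thesis by simp
qed

text \<open>Expanding the exponential in \<theta> i \<bullet> \<theta> j gives, for every k, a
  series over the levels with the same weights \<open>P N\<close>. The sum over the monomials of q
  is finite, so it may be taken inside the series. The comparison is then made level by level, and a
  series with real terms also shows that V is real.\<close>

lemma wave_packet_form_poly:
  fixes h :: real and n :: nat and c :: "nat \<Rightarrow> complex" and \<theta> :: "nat \<Rightarrow> 'a::euclidean_space" and q :: "real poly"
  defines "W i j \<equiv> wigner h (wave_packet h (\<theta> i)) (wave_packet h (\<theta> j))"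
  defines "V \<equiv> (\<Sum>i<n. \<Sum>j<n. c i * cnj (c j) *
      ((LINT Z|lborel. complex_of_real (poly q (exp (- (norm Z)\<^sup>2 / h))) * W i j Z) / complex_of_real ((2 * pi * h) ^ DIM('a))))"
  assumes h: "h > 0" and decr: "\<And>x. 0 \<le> x \<Longrightarrow> x \<le> 1 \<Longrightarrow> poly (pderiv q) x \<le> 0"
  shows "Im V = 0"
    and "coeff_pairing (\<lambda>c. 1 / c) q * (L2_norm (\<lambda>x. \<Sum>i<n. c i * wave_packet h (\<theta> i) x))\<^sup>2 \<le> Re V"
proof -
  let ?d = "DIM('a)"
  define \<kappa> where "\<kappa> = sqrt (pi * h) ^ ?d"
  \<comment> \<open>The per-packet Gaussian factors go into the coefficients; what remains depends
    on the frequencies only through \<theta> i \<bullet> \<theta> j.\<close>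
  define a where "a i = c i * complex_of_real (exp (- h / 4 * (norm (\<theta> i))\<^sup>2))" for i
  have "\<exists>r\<ge>0. (\<Sum>i<n. \<Sum>j<n. a i * cnj (a j) * complex_of_real ((\<theta> i \<bullet> \<theta> j) ^ N)) = complex_of_real r" for N
    by (rule gram_power_nonneg)
  then obtain g where g: "\<And>N. g N \<ge> 0"
    "\<And>N. (\<Sum>i<n. \<Sum>j<n. a i * cnj (a j) * complex_of_real ((\<theta> i \<bullet> \<theta> j) ^ N)) = complex_of_real (g N)"
    by metis
  define P where "P N = \<kappa> * ((h / 2) ^ N / fact N) * g N" for N
  have P0: "P N \<ge> 0" for N using h g by (simp add: P_def \<kappa>_def)
  have a: "c i * cnj (c j) * complex_of_real (\<kappa> * exp (- h / 4 * ((norm (\<theta> i))\<^sup>2 + (norm (\<theta> j))\<^sup>2)) * y)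
     = a i * cnj (a j) * complex_of_real (\<kappa> * y)" for i j y
  proof -
    have "exp (- h / 4 * ((norm (\<theta> i))\<^sup>2 + (norm (\<theta> j))\<^sup>2)) = exp (- h / 4 * (norm (\<theta> i))\<^sup>2) * exp (- h / 4 * (norm (\<theta> j))\<^sup>2)"
      by (simp add: mult_exp_exp algebra_simps)
    then show ?thesis by (simp only: a_def of_real_mult complex_cnj_mult complex_cnj_complex_of_real mult_ac)
  qed
  have sums: "(\<lambda>N. complex_of_real (P N * (v ^ N / e))) sums
      (\<Sum>i<n. \<Sum>j<n. a i * cnj (a j) * complex_of_real (\<kappa> * (exp (h / 2 * v * (\<theta> i \<bullet> \<theta> j)) / e)))" for v e :: real
  proof -
    have "(\<lambda>N. \<Sum>i<n. \<Sum>j<n. a i * cnj (a j) * complex_of_real (\<kappa> * ((h / 2 * v * (\<theta> i \<bullet> \<theta> j)) ^ N /\<^sub>R fact N / e))) sums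
      (\<Sum>i<n. \<Sum>j<n. a i * cnj (a j) * complex_of_real (\<kappa> * (exp (h / 2 * v * (\<theta> i \<bullet> \<theta> j)) / e)))"
      by (intro sums_sum sums_mult sums_of_real sums_divide exp_converges)
    moreover have "(\<Sum>i<n. \<Sum>j<n. a i * cnj (a j) * complex_of_real (\<kappa> * ((h / 2 * v * (\<theta> i \<bullet> \<theta> j)) ^ N /\<^sub>R fact N / e)))
       = complex_of_real (P N * (v ^ N / e))" for N
    proof -
      have "(\<Sum>i<n. \<Sum>j<n. a i * cnj (a j) * complex_of_real (\<kappa> * ((h / 2 * v * (\<theta> i \<bullet> \<theta> j)) ^ N /\<^sub>R fact N / e)))
        = (\<Sum>i<n. \<Sum>j<n. complex_of_real (\<kappa> * ((h / 2) ^ N / fact N) * (v ^ N / e)) * (a i * cnj (a j) * complex_of_real ((\<theta> i \<bullet> \<theta> j) ^ N)))"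
      proof (intro sum.cong refl)
        have summand: "\<kappa> * ((H * v * x) ^ N /\<^sub>R k / e) = \<kappa> * (H ^ N / k) * (v ^ N / e) * x ^ N" for H x k :: real
          by (simp add: power_mult_distrib divide_inverse mult_ac)
        show "a i * cnj (a j) * complex_of_real (\<kappa> * ((h / 2 * v * (\<theta> i \<bullet> \<theta> j)) ^ N /\<^sub>R fact N / e))
          = complex_of_real (\<kappa> * ((h / 2) ^ N / fact N) * (v ^ N / e)) * (a i * cnj (a j) * complex_of_real ((\<theta> i \<bullet> \<theta> j) ^ N))" for i j
          unfolding summand of_real_mult by (simp only: mult_ac)
      qed
      also have "\<dots> = complex_of_real (\<kappa> * ((h / 2) ^ N / fact N) * (v ^ N / e)) * complex_of_real (g N)"
        unfolding g(2)[symmetric] by (simp only: sum_distrib_left)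
      finally show ?thesis by (simp add: P_def mult_ac)
    qed
    ultimately show ?thesis by (simp only:)
  qed
  define D where "D k i j = (LINT Z|lborel. complex_of_real (exp (- real k * (norm Z)\<^sup>2 / h)) * W i j Z) / complex_of_real ((2 * pi * h) ^ ?d)" for k i j
  \<comment> \<open>The Gaussian symbol is used with s = k, so 1 + s is the argument
    \<open>real k + 1\<close> at which \<open>coeff_pairing\<close> evaluates its weight.\<close>
  have D: "(\<lambda>N. complex_of_real (P N * ((2 / (real k + 1) - 1) ^ N / (real k + 1) ^ ?d))) sums (\<Sum>i<n. \<Sum>j<n. c i * cnj (c j) * D k i j)" for k
  proof -
    have "c i * cnj (c j) * D k i j = a i * cnj (a j) * complex_of_real (\<kappa> * (exp (h / 2 * (2 / (real k + 1) - 1) * (\<theta> i \<bullet> \<theta> j)) / (real k + 1) ^ ?d))" for i j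
      using a[of i j "exp (h / 2 * (2 / (real k + 1) - 1) * (\<theta> i \<bullet> \<theta> j)) / (real k + 1) ^ ?d"]
      unfolding D_def W_def gaussian_weyl_wave_packet[OF h of_nat_0_le_iff] \<kappa>_def by (simp only: add.commute)
    then show ?thesis using sums[of "2 / (real k + 1) - 1" "(real k + 1) ^ ?d"] by (simp only:)
  qed
  have int_W: "integrable lborel (W i j)" for i j
    unfolding W_def by (rule integrable_wigner_wave_packet[OF h])
  have int: "integrable lborel (\<lambda>Z. complex_of_real (exp (- real k * (norm Z)\<^sup>2 / h)) * W i j Z)" for k i j
    by (rule integrable_bounded_mult[OF int_W, where B = 1]) (use h in auto)
  have V_D: "V = (\<Sum>k\<le>degree q. complex_of_real (coeff q k) * (\<Sum>i<n. \<Sum>j<n. c i * cnj (c j) * D k i j))"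
  proof -
    have "(LINT Z|lborel. complex_of_real (poly q (exp (- (norm Z)\<^sup>2 / h))) * W i j Z) / complex_of_real ((2 * pi * h) ^ ?d)
        = (\<Sum>k\<le>degree q. complex_of_real (coeff q k) * D k i j)" for i j
    proof -
      have "exp (- (norm Z)\<^sup>2 / h) ^ k = exp (- real k * (norm Z)\<^sup>2 / h)" for Z :: "'a \<times> 'a" and k
        by (simp add: exp_of_nat_mult[symmetric])
      then have "complex_of_real (poly q (exp (- (norm Z)\<^sup>2 / h))) * W i j Z =
          (\<Sum>k\<le>degree q. complex_of_real (coeff q k) * (complex_of_real (exp (- real k * (norm Z)\<^sup>2 / h)) * W i j Z))" for Z
        by (simp only: poly_altdef of_real_sum of_real_mult sum_distrib_right mult.assoc)
      then have "(LINT Z|lborel. complex_of_real (poly q (exp (- (norm Z)\<^sup>2 / h))) * W i j Z) =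
          (\<Sum>k\<le>degree q. complex_of_real (coeff q k) * (LINT Z|lborel. complex_of_real (exp (- real k * (norm Z)\<^sup>2 / h)) * W i j Z))"
        using int by (simp only: integral_mult_right_zero Bochner_Integration.integral_sum integrable_mult_right)
      then show ?thesis by (simp only: D_def sum_divide_distrib times_divide_eq_right)
    qed
    then have "V = (\<Sum>i<n. \<Sum>j<n. \<Sum>k\<le>degree q. complex_of_real (coeff q k) * (c i * cnj (c j) * D k i j))"
      unfolding V_def by (simp only: sum_distrib_left mult.left_commute)
    also have "\<dots> = (\<Sum>k\<le>degree q. \<Sum>i<n. \<Sum>j<n. complex_of_real (coeff q k) * (c i * cnj (c j) * D k i j))"
      by (rule trans[OF sum.cong[OF refl sum.swap] sum.swap])
    finally show ?thesis by (simp only: sum_distrib_left)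
  qed
  let ?R = "\<lambda>N. P N * coeff_pairing (\<lambda>c. (2 / c - 1) ^ N / c ^ ?d) q"
  have "(\<lambda>N. \<Sum>k\<le>degree q. complex_of_real (coeff q k) * complex_of_real (P N * ((2 / (real k + 1) - 1) ^ N / (real k + 1) ^ ?d))) sums V"
    unfolding V_D by (intro sums_sum sums_mult D)
  moreover have "(\<Sum>k\<le>degree q. complex_of_real (coeff q k) * complex_of_real (P N * ((2 / (real k + 1) - 1) ^ N / (real k + 1) ^ ?d)))
     = complex_of_real (?R N)" for N
    unfolding coeff_pairing_def sum_distrib_left of_real_sum by (simp add: mult_ac)
  ultimately have V: "(\<lambda>N. complex_of_real (?R N)) sums V" by (simp only:)
  have "(\<lambda>N. Im (complex_of_real (?R N))) sums Im V" by (rule sums_Im[OF V])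
  then show "Im V = 0" by (simp add: sums_iff)
  have Re_V: "?R sums Re V" using sums_Re[OF V] by simp
  have L2: "wave_packet h \<eta> \<in> L2_space" for \<eta> :: 'a
    by (intro schwartz_L2_space wave_packet_schwartz h)
  \<comment> \<open>The same series at v = 1 and e = 1: the weights add up to the squared
    norm.\<close>
  have "(\<lambda>N. complex_of_real (P N)) sums
     L2_inner (\<lambda>x. \<Sum>i<n. c i * wave_packet h (\<theta> i) x) (\<lambda>x. \<Sum>i<n. c i * wave_packet h (\<theta> i) x)"
  proof -
    have "c i * cnj (c j) * L2_inner (wave_packet h (\<theta> i)) (wave_packet h (\<theta> j)) =
       a i * cnj (a j) * complex_of_real (\<kappa> * (exp (h / 2 * 1 * (\<theta> i \<bullet> \<theta> j)) / 1))" for i j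
      using a[of i j "exp (h / 2 * 1 * (\<theta> i \<bullet> \<theta> j)) / 1"]
      unfolding L2_inner_wave_packet[OF h] \<kappa>_def by (simp only: mult_1_right div_by_1)
    then show ?thesis
      using sums[of 1 1] by (simp only: L2_inner_operator_lincomb_both[OF bounded_L2_operator_id L2]) simp
  qed
  then have "(\<lambda>N. complex_of_real (P N)) sums complex_of_real ((L2_norm (\<lambda>x. \<Sum>i<n. c i * wave_packet h (\<theta> i) x))\<^sup>2)"
    by (simp only: L2_inner_self)
  then have "P sums ((L2_norm (\<lambda>x. \<Sum>i<n. c i * wave_packet h (\<theta> i) x))\<^sup>2)"
    by (simp only: sums_of_real_iff)
  then have "(\<lambda>N. coeff_pairing (\<lambda>c. 1 / c) q * P N) sums (coeff_pairing (\<lambda>c. 1 / c) q * (L2_norm (\<lambda>x. \<Sum>i<n. c i * wave_packet h (\<theta> i) x))\<^sup>2)"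
    by (rule sums_mult)
  then show "coeff_pairing (\<lambda>c. 1 / c) q * (L2_norm (\<lambda>x. \<Sum>i<n. c i * wave_packet h (\<theta> i) x))\<^sup>2 \<le> Re V"
  proof (rule sums_le[OF _ _ Re_V, rotated])
    show "coeff_pairing (\<lambda>c. 1 / c) q * P N \<le> ?R N" for N
      using mult_left_mono[OF laguerre_eigenvalue_ge[OF decr, of ?d N] P0[of N]] by (simp add: mult.commute DIM_positive Suc_leI)
  qed
qed

section \<open>Limits and conclusion\<close>

lemma real_le_if_le_add_mult:
  fixes a b K :: real
  assumes "K \<ge> 0" and "\<And>e. e > 0 \<Longrightarrow> e \<le> 1 \<Longrightarrow> a \<le> b + e * K"
  shows "a \<le> b"
proof (rule field_le_epsilon)
  fix e :: real assume e: "e > 0"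
  have "min 1 (e / (K + 1)) * K \<le> e / (K + 1) * (K + 1)"
    using e assms(1) by (intro mult_mono) auto
  then show "a \<le> b + e"
    using assms(2)[of "min 1 (e / (K + 1))"] e assms(1) by simp
qed

theorem theorem1p1:
  fixes h :: real
    and F :: "(real ^ 'n) \<times> (real ^ 'n) \<Rightarrow> real"
    and \<Phi> :: "real \<Rightarrow> real"
    and Op :: "((real ^ 'n) \<Rightarrow> complex) \<Rightarrow> ((real ^ 'n) \<Rightarrow> complex)"
    and f :: "(real ^ 'n) \<Rightarrow> complex"
  assumes "h > 0"
    and "smooth F" and "bounded_derivs F"
    and "\<And>x \<xi>. F (x, \<xi>) = \<Phi> ((norm x)\<^sup>2 + (norm \<xi>)\<^sup>2)"
    and "mono_on {0..} \<Phi>"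
    and "is_weyl_op h F Op"
    and "f \<in> schwartz"
  shows "L2_inner (Op f) f \<in> \<real> \<and>
    Re (L2_inner (Op f) f) \<ge>
      (1 / h * (LINT t:{0..}|lborel. \<Phi> t * exp (- t / h))) * (L2_norm f)\<^sup>2"
proof -
  let ?d = "DIM(real ^ 'n)"
  note h = \<open>h > 0\<close> and mono = \<open>mono_on {0..} \<Phi>\<close>
  define I where "I = 1 / h * (LINT t:{0..}|lborel. \<Phi> t * exp (- t / h))"
  have op: "bounded_L2_operator Op"
    and weyl: "\<And>f g. f \<in> schwartz \<Longrightarrow> g \<in> schwartz \<Longrightarrow> L2_inner (Op f) g =
      (LINT Z|lborel. complex_of_real (F Z) * wigner h f g Z) / complex_of_real ((2 * pi * h) ^ ?d)"
    using \<open>is_weyl_op h F Op\<close> by (auto simp: is_weyl_op_def)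
  have F_norm: "F Z = \<Phi> ((norm Z)\<^sup>2)" for Z
    using assms(4)[of "fst Z" "snd Z"] by (simp add: norm_prod_def)
  have "\<forall>Z. partial_derivs [] F differentiable (at Z)"
    using \<open>smooth F\<close> unfolding smooth_def by (simp del: partial_derivs.simps)
  then have F_cont: "continuous_on UNIV F"
    by (simp add: differentiable_imp_continuous_within continuous_at_imp_continuous_on)
  have F_meas: "F \<in> borel_measurable borel" by (rule borel_measurable_continuous_onI[OF F_cont])
  have "bounded (range (partial_derivs [] F))"
    using \<open>bounded_derivs F\<close> unfolding bounded_derivs_def by (simp del: partial_derivs.simps)
  then obtain B where B: "\<bar>F Z\<bar> \<le> B" for Z by (auto simp: bounded_iff)
  \<comment> \<open>Along a ray in the first variable \<Phi> is a restriction of F, from which it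
    inherits continuity and boundedness on the half line.\<close>
  obtain e :: "real ^ 'n" where e: "norm e = 1" using norm_axis_1 by blast
  have \<Phi>_F: "\<Phi> t = F (sqrt t *\<^sub>R e, 0)" if "t \<ge> 0" for t
    using assms(4)[of "sqrt t *\<^sub>R e" 0] e that by simp
  have "continuous_on {0..} (\<lambda>t. F (sqrt t *\<^sub>R e, 0))"
    by (intro continuous_on_compose2[OF F_cont] continuous_intros) auto
  then have \<Phi>_cont: "continuous_on {0..} \<Phi>"
    by (rule continuous_on_eq) (simp add: \<Phi>_F)
  have \<Phi>_B: "\<bar>\<Phi> t\<bar> \<le> B" if "t \<ge> 0" for t using B \<Phi>_F[OF that] by simp
  have \<Phi>_int: "set_integrable lborel {0..} (\<lambda>t. \<Phi> t * exp (- t / h))"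
  proof (rule set_integrable_bound)
    show "set_integrable lborel {0..} (\<lambda>t. poly [:B:] (exp (- t / h)) * exp (- t / h))"
      by (rule exponential_poly_integral[OF h])
    have "continuous_on {0..} (\<lambda>t. \<Phi> t * exp (- t / h))"
      by (intro continuous_intros \<Phi>_cont) (use h in auto)
    then have "(\<lambda>t. indicator {0..} t *\<^sub>R (\<Phi> t * exp (- t / h))) \<in> borel_measurable borel"
      by (intro borel_measurable_continuous_on_indicator) auto
    then show "set_borel_measurable lborel {0..} (\<lambda>t. \<Phi> t * exp (- t / h))"
      by (simp add: set_borel_measurable_def del: real_scaleR_def)
    show "AE t in lborel. t \<in> {0..} \<longrightarrow> norm (\<Phi> t * exp (- t / h)) \<le> norm (poly [:B:] (exp (- t / h)) * exp (- t / h))"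
    proof (intro AE_I2 impI)
      fix t :: real assume "t \<in> {0..}"
      then have "\<bar>\<Phi> t\<bar> \<le> \<bar>B\<bar>" using \<Phi>_B[of t] by simp
      then show "norm (\<Phi> t * exp (- t / h)) \<le> norm (poly [:B:] (exp (- t / h)) * exp (- t / h))"
        by (simp add: abs_mult mult_right_mono)
    qed
  qed
  \<comment> \<open>The density exp (-t / h) / h has total mass 1, so a uniform error \<epsilon>
    changes the average by at most \<epsilon>.\<close>
  have I_le: "I \<le> coeff_pairing (\<lambda>c. 1 / c) q + \<epsilon>"
    if q: "\<And>t. 0 \<le> t \<Longrightarrow> \<bar>\<Phi> t - poly q (exp (- t / h))\<bar> < \<epsilon>" for q \<epsilon>
  proof -
    note q_int = exponential_poly_integral[OF h, of q] and \<epsilon>_int = exponential_poly_integral[OF h, of "[:\<epsilon>:]"]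
    have "(LINT t:{0..}|lborel. \<Phi> t * exp (- t / h)) \<le>
      (LINT t:{0..}|lborel. poly q (exp (- t / h)) * exp (- t / h) + poly [:\<epsilon>:] (exp (- t / h)) * exp (- t / h))"
    proof (rule set_integral_mono[OF \<Phi>_int set_integral_add(1)[OF q_int(1) \<epsilon>_int(1)]])
      fix t :: real assume "t \<in> {0..}"
      then have "\<Phi> t \<le> poly q (exp (- t / h)) + poly [:\<epsilon>:] (exp (- t / h))" using q[of t] by simp
      then show "\<Phi> t * exp (- t / h) \<le> poly q (exp (- t / h)) * exp (- t / h) + poly [:\<epsilon>:] (exp (- t / h)) * exp (- t / h)"
        unfolding distrib_right[symmetric] by (intro mult_right_mono) auto
    qed
    then have "I \<le> 1 / h * ((LINT t:{0..}|lborel. poly q (exp (- t / h)) * exp (- t / h)) +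
       (LINT t:{0..}|lborel. poly [:\<epsilon>:] (exp (- t / h)) * exp (- t / h)))"
      unfolding I_def set_integral_add(2)[OF q_int(1) \<epsilon>_int(1)] using h by (intro mult_left_mono) auto
    also have "\<dots> = coeff_pairing (\<lambda>c. 1 / c) q + coeff_pairing (\<lambda>c. 1 / c) [:\<epsilon>:]"
      unfolding distrib_left q_int(2) \<epsilon>_int(2) ..
    also have "coeff_pairing (\<lambda>c. 1 / c) [:\<epsilon>:] = \<epsilon>" by (simp add: coeff_pairing_def)
    finally show ?thesis .
  qed
  have packet_L2: "wave_packet h \<eta> \<in> L2_space" for \<eta> :: "real ^ 'n"
    by (intro schwartz_L2_space wave_packet_schwartz h)
  have packet: "Im (L2_inner (Op u) u) = 0 \<and> I * (L2_norm u)\<^sup>2 \<le> Re (L2_inner (Op u) u)"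
    if u: "u = (\<lambda>x. \<Sum>i<(n::nat). c i * wave_packet h (\<theta> i) x)" for u n c \<theta>
  proof -
    define W where "W i j = wigner h (wave_packet h (\<theta> i)) (wave_packet h (\<theta> j))" for i j
    define K where "K = complex_of_real ((2 * pi * h) ^ ?d)"
    \<comment> \<open>This bounds the change of the form per unit of uniform error in the symbol. It
      depends on the combination but not on \<epsilon>, so \<epsilon> can tend to 0 while u stays
      fixed.\<close>
    define M where "M = (\<Sum>i<n. \<Sum>j<n. norm (c i * cnj (c j)) * ((LINT Z|lborel. norm (W i j Z)) / norm K))"
    have M0: "M \<ge> 0" unfolding M_def by (intro sum_nonneg mult_nonneg_nonneg divide_nonneg_nonneg) auto
    have int_W: "integrable lborel (W i j)" for i j
      unfolding W_def by (rule integrable_wigner_wave_packet[OF h])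
    let ?z = "L2_inner (Op u) u"
    have z: "?z = (\<Sum>i<n. \<Sum>j<n. c i * cnj (c j) * ((LINT Z|lborel. complex_of_real (F Z) * W i j Z) / K))"
      unfolding u W_def K_def
      by (simp only: L2_inner_operator_lincomb_both[OF op packet_L2] weyl[OF wave_packet_schwartz[OF h] wave_packet_schwartz[OF h]])
    have approx: "\<bar>Im ?z\<bar> \<le> 0 + \<epsilon> * M \<and> I * (L2_norm u)\<^sup>2 \<le> Re ?z + \<epsilon> * (M + (L2_norm u)\<^sup>2)" if \<epsilon>: "\<epsilon> > 0" for \<epsilon>
    proof -
      obtain q where q: "\<And>x. 0 \<le> x \<Longrightarrow> x \<le> 1 \<Longrightarrow> poly (pderiv q) x \<le> 0"
        "\<And>t. 0 \<le> t \<Longrightarrow> \<bar>\<Phi> t - poly q (exp (- t / h))\<bar> < \<epsilon>"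
        using mono_exp_poly_approx[OF h \<Phi>_cont mono _ \<epsilon>, of B] \<Phi>_B abs_le_D1 by metis
      let ?p = "\<lambda>Z::(real ^ 'n) \<times> (real ^ 'n). poly q (exp (- (norm Z)\<^sup>2 / h))"
      define V where "V = (\<Sum>i<n. \<Sum>j<n. c i * cnj (c j) * ((LINT Z|lborel. complex_of_real (?p Z) * W i j Z) / K))"
      have V: "Im V = 0" "coeff_pairing (\<lambda>c. 1 / c) q * (L2_norm u)\<^sup>2 \<le> Re V"
        unfolding V_def W_def K_def u by (rule wave_packet_form_poly[OF h q(1)]; assumption)+
      have diff: "\<bar>F Z - ?p Z\<bar> \<le> \<epsilon>" for Z
        using q(2)[of "(norm Z)\<^sup>2"] by (simp add: F_norm)
      have p_meas: "?p \<in> borel_measurable borel"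
        by (intro borel_measurable_continuous_onI continuous_intros) (use h in auto)
      have p_B: "\<bar>?p Z\<bar> \<le> B + \<epsilon>" for Z
        using diff[of Z] B[of Z] by linarith
      have "norm (?z - V) \<le> \<epsilon> * M"
      proof -
        have diff_meas: "(\<lambda>Z. F Z - ?p Z) \<in> borel_measurable borel"
          by (intro borel_measurable_diff F_meas p_meas)
        have summand_le: "norm (c i * cnj (c j) * ((LINT Z|lborel. complex_of_real (F Z - ?p Z) * W i j Z) / K))
            \<le> norm (c i * cnj (c j)) * (\<epsilon> * (LINT Z|lborel. norm (W i j Z)) / norm K)" for i j
          unfolding norm_mult[of "c i * cnj (c j)"] norm_divide
          by (intro mult_left_mono divide_right_mono integral_bounded_mult_le[OF int_W diff_meas diff] norm_ge_zero)
        have "(LINT Z|lborel. complex_of_real (F Z) * W i j Z) / K - (LINT Z|lborel. complex_of_real (?p Z) * W i j Z) / K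
            = (LINT Z|lborel. complex_of_real (F Z - ?p Z) * W i j Z) / K" for i j
          unfolding of_real_diff left_diff_distrib
          by (subst Bochner_Integration.integral_diff[OF integrable_bounded_mult[OF int_W F_meas B]
                integrable_bounded_mult[OF int_W p_meas p_B]]) (rule diff_divide_distrib[symmetric])
        then have "?z - V = (\<Sum>i<n. \<Sum>j<n. c i * cnj (c j) * ((LINT Z|lborel. complex_of_real (F Z - ?p Z) * W i j Z) / K))"
          unfolding z V_def sum_subtractf[symmetric] right_diff_distrib[symmetric] by simp
        also have "norm \<dots> \<le> (\<Sum>i<n. \<Sum>j<n. norm (c i * cnj (c j)) * (\<epsilon> * (LINT Z|lborel. norm (W i j Z)) / norm K))"
          by (intro order_trans[OF norm_sum] sum_mono summand_le)
        also have "\<dots> = \<epsilon> * M"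
          unfolding M_def sum_distrib_left by (intro sum.cong refl) simp
        finally show ?thesis .
      qed
      then have "\<bar>Im ?z\<bar> \<le> \<epsilon> * M" "Re V \<le> Re ?z + \<epsilon> * M"
        using abs_Im_le_cmod[of "?z - V"] abs_Re_le_cmod[of "?z - V"] V(1) by auto
      moreover have "I * (L2_norm u)\<^sup>2 \<le> (coeff_pairing (\<lambda>c. 1 / c) q + \<epsilon>) * (L2_norm u)\<^sup>2"
        by (intro mult_right_mono I_le q) auto
      ultimately show ?thesis using V(2) by (simp add: distrib_left distrib_right)
    qed
    have "\<bar>Im ?z\<bar> \<le> 0"
      by (rule real_le_if_le_add_mult[OF M0 approx[THEN conjunct1]])
    moreover have "I * (L2_norm u)\<^sup>2 \<le> Re ?z"
      by (rule real_le_if_le_add_mult[OF _ approx[THEN conjunct2]]) (simp_all add: M0)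
    ultimately show ?thesis by simp
  qed
  obtain C where C: "C \<ge> 0" "\<And>f. f \<in> L2_space \<Longrightarrow> L2_norm (Op f) \<le> C * L2_norm f"
  proof -
    obtain C0 where "\<forall>f\<in>L2_space. L2_norm (Op f) \<le> C0 * L2_norm f"
      using op by (auto simp: bounded_L2_operator_def)
    then have "L2_norm (Op f) \<le> max 0 C0 * L2_norm f" if "f \<in> L2_space" for f
      using that mult_right_mono[OF max.cobounded2[of C0 0] L2_norm_nonneg[of f]] by fastforce
    then show ?thesis by (intro that[of "max 0 C0"]) auto
  qed
  have f: "f \<in> L2_space" "continuous_on UNIV f"
    using \<open>f \<in> schwartz\<close> by (rule schwartz_L2_space, rule schwartz_continuous)
  let ?z = "L2_inner (Op f) f"
  \<comment> \<open>The perturbation constant of f, common to the operator form (with factor C) and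
    to the squared norm (with factor 1).\<close>
  define N where "N = 2 * L2_norm f + 1"
  have N0: "N \<ge> 0" using L2_norm_nonneg[of f] by (simp add: N_def)
  have approx: "\<bar>Im ?z\<bar> \<le> 0 + \<delta> * (C * N) \<and> I * (L2_norm f)\<^sup>2 \<le> Re ?z + \<delta> * (C * N + \<bar>I\<bar> * N)"
    if \<delta>: "\<delta> > 0" "\<delta> \<le> 1" for \<delta>
  proof -
    obtain n :: nat and c \<theta> where less: "L2_norm (\<lambda>x. f x - (\<Sum>i<n. c i * wave_packet h (\<theta> i) x)) < \<delta>"
      using wave_packets_dense[OF h f \<delta>(1)] by blast
    define u where "u = (\<lambda>x. \<Sum>i<n. c i * wave_packet h (\<theta> i) x)"
    have u: "u \<in> L2_space" unfolding u_def by (rule L2_space_lincomb[OF packet_L2])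
    have le: "L2_norm (\<lambda>x. f x - u x) \<le> \<delta>" using less by (simp add: u_def)
    have "norm (?z - L2_inner (Op u) u) \<le> C * N * \<delta>"
      unfolding N_def by (rule L2_inner_operator_perturb[OF op f(1) u C le \<delta>(2)])
    moreover have "norm (L2_inner f f - L2_inner u u) \<le> 1 * N * \<delta>"
      unfolding N_def by (rule L2_inner_operator_perturb[OF bounded_L2_operator_id f(1) u _ _ le \<delta>(2)]) auto
    then have "\<bar>(L2_norm f)\<^sup>2 - (L2_norm u)\<^sup>2\<bar> \<le> N * \<delta>"
      unfolding L2_inner_self of_real_diff[symmetric] norm_of_real by simp
    \<comment> \<open>The constant I may have either sign, so both directions of the norm comparison
      are kept and its absolute value is used.\<close>
    then have "\<bar>I\<bar> * \<bar>(L2_norm f)\<^sup>2 - (L2_norm u)\<^sup>2\<bar> \<le> \<bar>I\<bar> * (N * \<delta>)"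
      by (rule mult_left_mono) simp
    then have "I * (L2_norm f)\<^sup>2 - I * (L2_norm u)\<^sup>2 \<le> \<bar>I\<bar> * (N * \<delta>)"
      unfolding abs_mult[symmetric] right_diff_distrib by linarith
    moreover have "Im (L2_inner (Op u) u) = 0" "I * (L2_norm u)\<^sup>2 \<le> Re (L2_inner (Op u) u)"
      using packet[OF u_def] by auto
    ultimately show ?thesis
      using abs_Im_le_cmod[of "?z - L2_inner (Op u) u"] abs_Re_le_cmod[of "?z - L2_inner (Op u) u"]
      by (auto simp: algebra_simps)
  qed
  have "\<bar>Im ?z\<bar> \<le> 0"
    by (rule real_le_if_le_add_mult[OF _ approx[THEN conjunct1]]) (simp_all add: C(1) N0)
  moreover have "I * (L2_norm f)\<^sup>2 \<le> Re ?z"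
    by (rule real_le_if_le_add_mult[OF _ approx[THEN conjunct2]]) (simp_all add: C(1) N0)
  ultimately show ?thesis
    by (simp add: complex_is_Real_iff I_def)
qed

end
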